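(* Let $G$ be an abelian (locally compact) group, $(X,G)$ a minimal continuous action and $m\in\mathbb{N}$, $m\geq 2$. Then $(X,G)$ is $m$-equicontinuous if and only if $r_M(X,G)\leq m-1$.
   Context: $G$ acts continuously on a compact metric space $(X,d)$; minimal means every orbit is dense. $(X,G)$ is $m$-equicontinuous if for every $x\in X$ and $\varepsilon>0$ there is $\delta>0$ such that for any $x_1,\dots,x_m$ in the open ball $B_\delta(x)$ and every $g\in G$ there exist $i\neq j$ with $d(gx_i,gx_j)<\varepsilon$. The maximal equicontinuous factor $\pi_{eq}\colon X\to X_{eq}$ is the factor map onto the equicontinuous factor of $(X,G)$ of which every equicontinuous factor is a factor. The maximal rank is $r_M(X,G)=\sup\{|\pi_{eq}^{-1}(y)|: y\in X_{eq}\}$. *)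

theory Defs
  imports "HOL-Analysis.Analysis" "HOL-Library.Extended_Nat"
begin

text \<open>A continuous action of the topological group 'g on the compact metric space X
  (X is a subset of a metric-space type; the action is written additively since G is abelian).\<close>
definition cont_action :: "('g::topological_group_add \<Rightarrow> 'x::metric_space \<Rightarrow> 'x) \<Rightarrow> 'x set \<Rightarrow> bool" where
  "cont_action act X \<longleftrightarrow>
     compact X \<and>
     (\<forall>g x. x \<in> X \<longrightarrow> act g x \<in> X) \<and>
     (\<forall>x\<in>X. act 0 x = x) \<and>
     (\<forall>g h x. x \<in> X \<longrightarrow> act (g + h) x = act g (act h x)) \<and>
     continuous_on (UNIV \<times> X) (\<lambda>(g, x). act g x)"

definition minimal_action :: "('g \<Rightarrow> 'x::metric_space \<Rightarrow> 'x) \<Rightarrow> 'x set \<Rightarrow> bool" where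
  "minimal_action act X \<longleftrightarrow> (\<forall>x\<in>X. closure (range (\<lambda>g. act g x)) = X)"

definition equicontinuous_action :: "('g \<Rightarrow> 'y::metric_space \<Rightarrow> 'y) \<Rightarrow> 'y set \<Rightarrow> bool" where
  "equicontinuous_action act Y \<longleftrightarrow>
     (\<forall>e>0. \<exists>d>0. \<forall>y\<in>Y. \<forall>y'\<in>Y. dist y y' < d \<longrightarrow> (\<forall>g. dist (act g y) (act g y') < e))"

definition m_equicontinuous :: "nat \<Rightarrow> ('g \<Rightarrow> 'x::metric_space \<Rightarrow> 'x) \<Rightarrow> 'x set \<Rightarrow> bool" where
  "m_equicontinuous m act X \<longleftrightarrow>
     (\<forall>x\<in>X. \<forall>e>0. \<exists>d>0. \<forall>xs :: nat \<Rightarrow> 'x.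
        (\<forall>i<m. xs i \<in> X \<and> xs i \<in> ball x d) \<longrightarrow>
        (\<forall>g. \<exists>i<m. \<exists>j<m. i \<noteq> j \<and> dist (act g (xs i)) (act g (xs j)) < e))"

definition factor_map ::
  "('g::topological_group_add \<Rightarrow> 'x::metric_space \<Rightarrow> 'x) \<Rightarrow> 'x set \<Rightarrow>
   ('g \<Rightarrow> 'y::metric_space \<Rightarrow> 'y) \<Rightarrow> 'y set \<Rightarrow> ('x \<Rightarrow> 'y) \<Rightarrow> bool" where
  "factor_map act X act' Y p \<longleftrightarrow>
     cont_action act X \<and> cont_action act' Y \<and>
     continuous_on X p \<and> p ` X = Y \<and>
     (\<forall>g. \<forall>x\<in>X. p (act g x) = act' g (p x))"

text \<open>Maximal equicontinuous factor. Every compact metric space is isometric to a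
  compact subset of the Hilbert-cube type nat \<Rightarrow> real (with its product metric), so every
  equicontinuous factor of (X, act) is conjugate to one living in that type; maximality is
  therefore tested against all equicontinuous factors in nat \<Rightarrow> real.\<close>
definition max_eq_factor ::
  "('g::topological_group_add \<Rightarrow> 'x::metric_space \<Rightarrow> 'x) \<Rightarrow> 'x set \<Rightarrow>
   ('g \<Rightarrow> 'y::metric_space \<Rightarrow> 'y) \<Rightarrow> 'y set \<Rightarrow> ('x \<Rightarrow> 'y) \<Rightarrow> bool" where
  "max_eq_factor act X act' Y p \<longleftrightarrow>
     factor_map act X act' Y p \<and> equicontinuous_action act' Y \<and>
     (\<forall>(act'' :: 'g \<Rightarrow> (nat \<Rightarrow> real) \<Rightarrow> (nat \<Rightarrow> real)) Z q.
        factor_map act X act'' Z q \<and> equicontinuous_action act'' Z \<longrightarrow>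
        (\<exists>f. factor_map act' Y act'' Z f \<and> (\<forall>x\<in>X. q x = f (p x))))"

definition max_rank :: "'x set \<Rightarrow> 'y set \<Rightarrow> ('x \<Rightarrow> 'y) \<Rightarrow> enat" where
  "max_rank X Y p = (SUP y\<in>Y. (let F = {x\<in>X. p x = y} in if finite F then enat (card F) else \<infinity>))"

end

theory Submission
  imports Defs "HOL-Library.Function_Algebras"
begin

text \<open>
  If \<open>m\<close>-equicontinuity fails, limits of translates of nearby points give \<open>m\<close> distinct points that
  the equicontinuous factor cannot separate.

  For the other direction, McMahon's argument shows that any \<open>m\<close> points \<open>z\<close> of one fibre are jointly
  regionally proximal. For a closed set \<open>N\<close> of sequences that is invariant under the diagonal action,
  the slices \<open>N(x)\<close> in one coordinate move equivariantly with \<open>x\<close>, so \<open>\<lambda>(N(x) \<Delta> N(y))\<close> is a continuous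
  invariant pseudometric on \<open>X\<close> for any invariant \<open>\<lambda>\<close>, and hence vanishes on the fibres of the maximal
  equicontinuous factor. If \<open>\<lambda>\<close> charges open sets, a relatively open set contained in \<open>N(x)\<close> is then
  contained in \<open>N(y)\<close> for every \<open>y\<close> in the fibre of \<open>x\<close>. Applied coordinate by coordinate to the closure \<open>N\<close>
  of the translates of \<open>U\<^sup>m\<close>, for a small ball \<open>U\<close>, this puts \<open>z\<close> into \<open>N\<close>, against
  \<open>m\<close>-equicontinuity.

  No Borel measure is needed: \<open>\<lambda>\<close> is the outer content on closed sets induced by a finitely additive
  invariant mean, which exists because the acting group is abelian.
\<close>

section \<open>Invariant means on abelian groups\<close>

text \<open>Every subset gets a value, so pulling back along an arbitrary map stays in the class,
  and each defining condition survives pointwise limits.\<close>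

definition fin_add_prob :: "('a set \<Rightarrow> real) \<Rightarrow> bool" where
  "fin_add_prob \<mu> \<longleftrightarrow> \<mu> UNIV = 1 \<and> (\<forall>A. 0 \<le> \<mu> A) \<and>
     (\<forall>A B. A \<inter> B = {} \<longrightarrow> \<mu> (A \<union> B) = \<mu> A + \<mu> B)"

lemma fin_add_prob_disjoint:
  "fin_add_prob \<mu> \<Longrightarrow> A \<inter> B = {} \<Longrightarrow> \<mu> (A \<union> B) = \<mu> A + \<mu> B"
  by (simp add: fin_add_prob_def)

lemma fin_add_prob_nonneg: "fin_add_prob \<mu> \<Longrightarrow> 0 \<le> \<mu> A"
  by (simp add: fin_add_prob_def)

lemma fin_add_prob_UNIV: "fin_add_prob \<mu> \<Longrightarrow> \<mu> UNIV = 1"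
  by (simp add: fin_add_prob_def)

lemma fin_add_prob_mono:
  assumes "fin_add_prob \<mu>" "A \<subseteq> B"
  shows "\<mu> A \<le> \<mu> B"
proof -
  have "\<mu> (A \<union> (B - A)) = \<mu> A + \<mu> (B - A)"
    by (rule fin_add_prob_disjoint[OF assms(1)]) auto
  moreover have "A \<union> (B - A) = B" using assms(2) by auto
  ultimately show ?thesis using fin_add_prob_nonneg[OF assms(1), of "B - A"] by simp
qed

lemma fin_add_prob_le_1: "fin_add_prob \<mu> \<Longrightarrow> \<mu> A \<le> 1"
  using fin_add_prob_mono[of \<mu> A UNIV] fin_add_prob_UNIV[of \<mu>] by simp

lemma fin_add_prob_Un_Int:
  assumes "fin_add_prob \<mu>"
  shows "\<mu> (A \<union> B) + \<mu> (A \<inter> B) = \<mu> A + \<mu> B"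
proof -
  have "\<mu> (A \<union> (B - A)) = \<mu> A + \<mu> (B - A)"
    by (rule fin_add_prob_disjoint[OF assms]) auto
  moreover have "\<mu> ((A \<inter> B) \<union> (B - A)) = \<mu> (A \<inter> B) + \<mu> (B - A)"
    by (rule fin_add_prob_disjoint[OF assms]) auto
  moreover have "A \<union> (B - A) = A \<union> B" "(A \<inter> B) \<union> (B - A) = B" by auto
  ultimately show ?thesis by simp
qed

lemma fin_add_prob_UN_le:
  assumes "fin_add_prob \<mu>" "finite I"
  shows "\<mu> (\<Union>i\<in>I. A i) \<le> (\<Sum>i\<in>I. \<mu> (A i))"
  using assms(2)
proof (induction I rule: finite_induct)
  case empty
  show ?case using fin_add_prob_disjoint[OF assms(1), of "{}" "{}"] by simp
next
  case (insert i I)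
  show ?case
    using fin_add_prob_Un_Int[OF assms(1), of "A i" "\<Union>i\<in>I. A i"]
      fin_add_prob_nonneg[OF assms(1), of "A i \<inter> (\<Union>i\<in>I. A i)"] insert by simp
qed

lemma fin_add_prob_vimage:
  "fin_add_prob \<mu> \<Longrightarrow> fin_add_prob (\<lambda>A. \<mu> (f -` A))"
  unfolding fin_add_prob_def by (auto simp: vimage_Un) (metis vimage_Int vimage_empty)

lemma closed_fin_add_prob: "closed {\<mu>. fin_add_prob \<mu>}"
proof -
  have ev: "continuous_on UNIV (\<lambda>\<mu>::'a set \<Rightarrow> real. \<mu> A)" for A
    by (rule continuous_on_product_coordinates)
  have "{\<mu> :: 'a set \<Rightarrow> real. fin_add_prob \<mu>} =
      {\<mu>. \<mu> UNIV = 1} \<inter> (\<Inter>A. {\<mu>. 0 \<le> \<mu> A}) \<inter>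
      (\<Inter>A. \<Inter>B\<in>{B. A \<inter> B = {}}. {\<mu>. \<mu> (A \<union> B) = \<mu> A + \<mu> B})"
    unfolding fin_add_prob_def by auto
  also have "closed \<dots>"
    by (intro closed_Int closed_INT ballI closed_Collect_eq closed_Collect_le ev
        continuous_on_add continuous_on_const)
  finally show ?thesis .
qed

text \<open>Tychonoff: the class is a closed part of the cube of all \<open>{0..1}\<close>-valued
  set functions with pointwise convergence.\<close>

lemma compact_fin_add_prob: "compact {\<mu>. fin_add_prob \<mu>}"
proof -
  have "compactin (product_topology (\<lambda>_. euclidean) UNIV)
      (PiE UNIV (\<lambda>_ :: 'a set. {0..1::real}))"
    by (subst compactin_PiE) auto
  then have "compact (PiE UNIV (\<lambda>_ :: 'a set. {0..1::real}))"
    by (simp add: euclidean_product_topology)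
  moreover have "{\<mu>. fin_add_prob \<mu>} = PiE UNIV (\<lambda>_ :: 'a set. {0..1::real}) \<inter> {\<mu>. fin_add_prob \<mu>}"
    by (auto simp: fin_add_prob_nonneg fin_add_prob_le_1)
  ultimately show ?thesis
    using closed_fin_add_prob compact_Int_closed by metis
qed

definition translation_invariant :: "('h::plus set \<Rightarrow> real) \<Rightarrow> 'h \<Rightarrow> bool" where
  "translation_invariant \<mu> a \<longleftrightarrow> (\<forall>A. \<mu> ((+) a -` A) = \<mu> A)"

text \<open>The slack \<open>e\<close> is for averages, whose invariance holds only up to
  \<open>1 / real n\<close>; exact invariance is the case \<open>e = 0\<close>.\<close>

lemma closed_almost_translation_invariant:
  "closed {\<mu> :: 'h::plus set \<Rightarrow> real. \<forall>A. \<bar>\<mu> ((+) a -` A) - \<mu> A\<bar> \<le> e}"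
proof -
  have ev: "continuous_on UNIV (\<lambda>\<mu>::'h set \<Rightarrow> real. \<mu> A)" for A
    by (rule continuous_on_product_coordinates)
  have "closed (\<Inter>A. {\<mu> :: 'h set \<Rightarrow> real. \<bar>\<mu> ((+) a -` A) - \<mu> A\<bar> \<le> e})"
    by (intro closed_INT ballI closed_Collect_le continuous_intros ev)
  moreover have "(\<Inter>A. {\<mu> :: 'h set \<Rightarrow> real. \<bar>\<mu> ((+) a -` A) - \<mu> A\<bar> \<le> e}) =
     {\<mu>. \<forall>A. \<bar>\<mu> ((+) a -` A) - \<mu> A\<bar> \<le> e}" by auto
  ultimately show ?thesis by simp
qed

lemma closed_translation_invariant:
  "closed {\<mu> :: 'h::plus set \<Rightarrow> real. translation_invariant \<mu> a}"
  using closed_almost_translation_invariant[of a 0] by (simp add: translation_invariant_def)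

text \<open>Averaging over the first \<open>n\<close> multiples of \<open>a\<close> makes a mean almost \<open>a\<close>-invariant and, by
  commutativity, keeps the invariances it already has.\<close>

lemma almost_invariant_average:
  fixes a :: "'h::ab_group_add"
  assumes \<mu>: "fin_add_prob \<mu>" and inv: "\<And>b. b \<in> F \<Longrightarrow> translation_invariant \<mu> b" and n: "n > 0"
  obtains \<nu> where "fin_add_prob \<nu>" "\<And>b. b \<in> F \<Longrightarrow> translation_invariant \<nu> b"
    "\<And>A. \<bar>\<nu> ((+) a -` A) - \<nu> A\<bar> \<le> 1 / real n"
proof
  define T where "T = (\<lambda>j::nat. ((+) a ^^ j))"
  define \<nu> where "\<nu> = (\<lambda>A. (\<Sum>j<n. \<mu> (T j -` A)) / real n)"
  have Tj: "fin_add_prob (\<lambda>A. \<mu> (T j -` A))" for j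
    by (rule fin_add_prob_vimage[OF \<mu>])
  show "fin_add_prob \<nu>"
    unfolding fin_add_prob_def
  proof (intro conjI allI impI)
    show "\<nu> UNIV = 1" using n fin_add_prob_UNIV[OF \<mu>] by (simp add: \<nu>_def)
    show "0 \<le> \<nu> A" for A
      unfolding \<nu>_def by (intro divide_nonneg_nonneg sum_nonneg fin_add_prob_nonneg[OF Tj]) auto
    show "\<nu> (A \<union> B) = \<nu> A + \<nu> B" if "A \<inter> B = {}" for A B
      using fin_add_prob_disjoint[OF Tj that]
      by (simp add: \<nu>_def sum.distrib add_divide_distrib)
  qed
  have comm: "T j (b + x) = b + T j x" for j b x
    unfolding T_def by (induction j) (auto simp: algebra_simps)
  show "translation_invariant \<nu> b" if "b \<in> F" for b
    unfolding translation_invariant_def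
  proof
    fix A
    have "T j -` (+) b -` A = (+) b -` T j -` A" for j
      by (auto simp: comm)
    then show "\<nu> ((+) b -` A) = \<nu> A"
      using inv[OF that] unfolding translation_invariant_def \<nu>_def by simp
  qed
  fix A
  \<comment> \<open>One more translation by \<open>a\<close> shifts the index, so the difference
    telescopes to two values in \<open>{0..1}\<close>, divided by \<open>n\<close>.\<close>
  have "T j -` (+) a -` A = T (Suc j) -` A" for j
    unfolding T_def by auto
  then have "\<nu> ((+) a -` A) - \<nu> A = (\<Sum>j<n. \<mu> (T (Suc j) -` A) - \<mu> (T j -` A)) / real n"
    by (simp add: \<nu>_def sum_subtractf diff_divide_distrib)
  also have "\<dots> = (\<mu> (T n -` A) - \<mu> (T 0 -` A)) / real n"
    by (subst sum_lessThan_telescope) simp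
  finally show "\<bar>\<nu> ((+) a -` A) - \<nu> A\<bar> \<le> 1 / real n"
    using n fin_add_prob_nonneg[OF \<mu>, of "T n -` A"] fin_add_prob_nonneg[OF \<mu>, of "T 0 -` A"]
      fin_add_prob_le_1[OF \<mu>, of "T n -` A"] fin_add_prob_le_1[OF \<mu>, of "T 0 -` A"]
    by (simp add: abs_le_iff divide_right_mono field_simps)
qed

text \<open>Induction on \<open>F\<close>: the means invariant under \<open>F\<close> form a compact
  set. Averages along a new element \<open>a\<close> stay in it with a defect tending to 0, so some
  member has defect 0.\<close>

lemma finitely_invariant_mean_exists:
  fixes F :: "'h::ab_group_add set"
  assumes "finite F"
  shows "\<exists>\<mu>. fin_add_prob \<mu> \<and> (\<forall>b\<in>F. translation_invariant \<mu> b)"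
  using assms
proof (induction F rule: finite_induct)
  case empty
  \<comment> \<open>The base case is the point mass at 0.\<close>
  have "fin_add_prob (\<lambda>A. if (0::'h) \<in> A then 1 else 0)"
    unfolding fin_add_prob_def by auto
  then show ?case by blast
next
  case (insert a F)
  let ?S = "{\<mu>. fin_add_prob \<mu>} \<inter> (\<Inter>b\<in>F. {\<mu>. translation_invariant \<mu> b})"
  let ?E = "\<lambda>n::nat. {\<mu> :: 'h set \<Rightarrow> real. \<forall>A. \<bar>\<mu> ((+) a -` A) - \<mu> A\<bar> \<le> 1 / real (Suc n)}"
  have "compact ?S"
    by (intro compact_Int_closed compact_fin_add_prob closed_INT ballI closed_translation_invariant)
  moreover have "?S \<inter> (\<Inter>n\<in>I. ?E n) \<noteq> {}" if I: "finite I" for I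
  proof -
    obtain \<mu> where "fin_add_prob \<mu>" "\<And>b. b \<in> F \<Longrightarrow> translation_invariant \<mu> b"
      using insert.IH by blast
    \<comment> \<open>The sets \<open>?E n\<close> shrink as \<open>n\<close> grows, so the largest
      index serves all of \<open>I\<close>; \<open>insert 0\<close> keeps \<open>Max\<close>
      meaningful for empty \<open>I\<close>.\<close>
    then obtain \<nu> where \<nu>: "fin_add_prob \<nu>" "\<And>b. b \<in> F \<Longrightarrow> translation_invariant \<nu> b"
      "\<And>A. \<bar>\<nu> ((+) a -` A) - \<nu> A\<bar> \<le> 1 / real (Suc (Max (insert 0 I)))"
      by (rule almost_invariant_average[where n = "Suc (Max (insert 0 I))" and a = a]) auto
    have "\<nu> \<in> ?E n" if "n \<in> I" for n
    proof -
      have "n \<le> Max (insert 0 I)" using I that by simp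
      then have "1 / real (Suc (Max (insert 0 I))) \<le> 1 / real (Suc n)"
        by (intro divide_left_mono) auto
      then show ?thesis using \<nu>(3) order_trans by blast
    qed
    then show ?thesis using \<nu> by blast
  qed
  ultimately have "?S \<inter> (\<Inter>n. ?E n) \<noteq> {}"
    by (rule compact_imp_fip_image[OF _ closed_almost_translation_invariant])
  then obtain \<mu> where \<mu>: "fin_add_prob \<mu>" "\<forall>b\<in>F. translation_invariant \<mu> b" "\<And>n. \<mu> \<in> ?E n"
    by blast
  have "\<mu> ((+) a -` A) = \<mu> A" for A
  proof (rule ccontr)
    assume "\<mu> ((+) a -` A) \<noteq> \<mu> A"
    then obtain n where "1 / real (Suc n) < \<bar>\<mu> ((+) a -` A) - \<mu> A\<bar>"
      using nat_approx_posE[of "\<bar>\<mu> ((+) a -` A) - \<mu> A\<bar>"] by auto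
    moreover have "\<bar>\<mu> ((+) a -` A) - \<mu> A\<bar> \<le> 1 / real (Suc n)"
      using \<mu>(3)[of n] by blast
    ultimately show False by linarith
  qed
  then show ?case using \<mu> by (auto simp: translation_invariant_def)
qed

text \<open>Amenability of abelian groups, taken as discrete groups: compactness passes from
  finitely many translations to all of them.\<close>

theorem invariant_mean_exists:
  obtains \<mu> :: "'h::ab_group_add set \<Rightarrow> real"
  where "fin_add_prob \<mu>" "\<And>a A. \<mu> ((+) a -` A) = \<mu> A"
proof -
  have "{\<mu>. fin_add_prob \<mu>} \<inter> (\<Inter>a\<in>F. {\<mu>. translation_invariant \<mu> a}) \<noteq> {}" if "finite F" for F :: "'h set"
    using finitely_invariant_mean_exists[OF that] by auto
  then have "{\<mu>. fin_add_prob \<mu>} \<inter> (\<Inter>a :: 'h. {\<mu>. translation_invariant \<mu> a}) \<noteq> {}"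
    by (rule compact_imp_fip_image[OF compact_fin_add_prob closed_translation_invariant])
  then show thesis using that by (auto simp: translation_invariant_def)
qed

section \<open>Outer content of a finitely additive mean\<close>

text \<open>Outer regularisation: a closed set is approximated from outside by relatively open ones
  by construction, which a merely finitely additive mean does not guarantee.\<close>

definition outer_content :: "('w::metric_space set \<Rightarrow> real) \<Rightarrow> 'w set \<Rightarrow> 'w set \<Rightarrow> real" where
  "outer_content \<nu> W K = (INF V\<in>{V. openin (top_of_set W) V \<and> K \<subseteq> V}. \<nu> V)"

lemma outer_content_le:
  assumes "fin_add_prob \<nu>" "openin (top_of_set W) V" "K \<subseteq> V"
  shows "outer_content \<nu> W K \<le> \<nu> V"
  unfolding outer_content_def
  by (rule cINF_lower) (use assms in \<open>auto intro!: bdd_belowI2[where m = 0] fin_add_prob_nonneg\<close>)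

lemma outer_content_greatest:
  assumes "K \<subseteq> W" "\<And>V. openin (top_of_set W) V \<Longrightarrow> K \<subseteq> V \<Longrightarrow> c \<le> \<nu> V"
  shows "c \<le> outer_content \<nu> W K"
proof -
  have "W \<in> {V. openin (top_of_set W) V \<and> K \<subseteq> V}" using assms(1) by simp
  then show ?thesis unfolding outer_content_def
    by (intro cINF_greatest) (use assms in auto)
qed

lemma outer_content_approx:
  assumes "fin_add_prob \<nu>" "K \<subseteq> W" "e > 0"
  obtains V where "openin (top_of_set W) V" "K \<subseteq> V" "\<nu> V < outer_content \<nu> W K + e"
proof -
  have "\<exists>V. openin (top_of_set W) V \<and> K \<subseteq> V \<and> \<nu> V < outer_content \<nu> W K + e"
  proof (rule ccontr)
    assume "\<not> ?thesis"
    then have "outer_content \<nu> W K + e \<le> outer_content \<nu> W K"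
      by (intro outer_content_greatest) (use assms in \<open>auto simp: not_less\<close>)
    then show False using assms by simp
  qed
  then show thesis using that by blast
qed

lemma outer_content_mono:
  assumes "fin_add_prob \<nu>" "K \<subseteq> L" "L \<subseteq> W"
  shows "outer_content \<nu> W K \<le> outer_content \<nu> W L"
  by (rule outer_content_greatest) (use assms in \<open>auto intro: outer_content_le\<close>)

text \<open>Neighbourhoods of \<open>A\<close> and \<open>B\<close> that meet only
  inside a prescribed neighbourhood of \<open>A \<inter> B\<close> come from normality.\<close>

lemma outer_content_supermodular:
  assumes \<nu>: "fin_add_prob \<nu>" and W: "closed W" and "A \<subseteq> W" "B \<subseteq> W" "closed A" "closed B"
  shows "outer_content \<nu> W A + outer_content \<nu> W B
    \<le> outer_content \<nu> W (A \<union> B) + outer_content \<nu> W (A \<inter> B)"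
proof (rule field_le_epsilon)
  fix e :: real assume "e > 0"
  then have e2: "e / 2 > 0" by simp
  have "A \<union> B \<subseteq> W" "A \<inter> B \<subseteq> W" using assms by auto
  obtain S where S: "openin (top_of_set W) S" "A \<union> B \<subseteq> S"
      "\<nu> S < outer_content \<nu> W (A \<union> B) + e / 2"
    using outer_content_approx[OF \<nu> \<open>A \<union> B \<subseteq> W\<close> e2] by blast
  obtain T where T: "openin (top_of_set W) T" "A \<inter> B \<subseteq> T"
      "\<nu> T < outer_content \<nu> W (A \<inter> B) + e / 2"
    using outer_content_approx[OF \<nu> \<open>A \<inter> B \<subseteq> W\<close> e2] by blast
  obtain T' where T': "open T'" "T = W \<inter> T'" using T(1) by (auto simp: openin_open)
  have "closed (A - T')" "closed (B - T')"
    using assms T' by (auto intro: closed_Diff)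
  moreover have "(A - T') \<inter> (B - T') = {}" using T T' assms by auto
  ultimately obtain P Q where PQ: "open P" "open Q" "A - T' \<subseteq> P" "B - T' \<subseteq> Q" "P \<inter> Q = {}"
    using t4_space by metis
  \<comment> \<open>Both sets stay inside \<open>S\<close>, and since \<open>P\<close> and
    \<open>Q\<close> are disjoint they meet only inside \<open>T\<close>; modularity of the mean
    then gives the inequality.\<close>
  define S1 where "S1 = S \<inter> ((W \<inter> P) \<union> T)"
  define S2 where "S2 = S \<inter> ((W \<inter> Q) \<union> T)"
  have "openin (top_of_set W) (W \<inter> P)" "openin (top_of_set W) (W \<inter> Q)"
    using PQ by (auto simp: openin_open)
  then have op: "openin (top_of_set W) S1" "openin (top_of_set W) S2"
    using S T unfolding S1_def S2_def by blast+
  have "A \<subseteq> S1" "B \<subseteq> S2" unfolding S1_def S2_def using S T' PQ assms by auto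
  then have "outer_content \<nu> W A \<le> \<nu> S1" "outer_content \<nu> W B \<le> \<nu> S2"
    using op by (auto intro!: outer_content_le[OF \<nu>])
  moreover have "\<nu> (S1 \<union> S2) \<le> \<nu> S" "\<nu> (S1 \<inter> S2) \<le> \<nu> T"
    using PQ by (auto intro!: fin_add_prob_mono[OF \<nu>] simp: S1_def S2_def)
  ultimately show "outer_content \<nu> W A + outer_content \<nu> W B
      \<le> outer_content \<nu> W (A \<union> B) + outer_content \<nu> W (A \<inter> B) + e"
    using fin_add_prob_Un_Int[OF \<nu>, of S1 S2] S(3) T(3) by linarith
qed

section \<open>Minimal flows and their sequence spaces\<close>

text \<open>The product metric sums truncated coordinate distances with weights
  \<open>(1/2)^n\<close>, whose total is 2.\<close>

lemma dist_fun_le: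
  fixes x y :: "nat \<Rightarrow> 'x::metric_space"
  assumes "\<And>i. dist (x i) (y i) \<le> e"
  shows "dist x y \<le> 2 * e"
proof -
  have *: "(1/2)^n * min (dist (x (from_nat n)) (y (from_nat n))) 1 \<le> e * (1/2)^n" for n :: nat
  proof -
    have "min (dist (x (from_nat n)) (y (from_nat n))) 1 \<le> e"
      using assms[of "from_nat n"] by linarith
    then show ?thesis by (simp add: mult.commute mult_left_mono)
  qed
  have "dist x y \<le> (\<Sum>n. e * (1/2)^n)"
    unfolding dist_fun_def
    by (rule suminf_le[OF *])
      (auto intro!: summable_mult summable_geometric
        intro: summable_comparison_test'[of "\<lambda>n. (1/2)^n :: real"])
  also have "\<dots> = 2 * e"
    by (subst suminf_mult) (auto simp: suminf_geometric summable_geometric)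
  finally show ?thesis .
qed

locale minimal_flow =
  fixes act :: "'g::topological_ab_group_add \<Rightarrow> 'x::metric_space \<Rightarrow> 'x" and X :: "'x set"
  assumes cont_action: "cont_action act X" and minimal_action: "minimal_action act X"
begin

lemma compact_X: "compact X" and act_in: "x \<in> X \<Longrightarrow> act g x \<in> X"
  and act_0: "x \<in> X \<Longrightarrow> act 0 x = x"
  and act_add: "x \<in> X \<Longrightarrow> act (g + h) x = act g (act h x)"
  and act_continuous: "continuous_on (UNIV \<times> X) (\<lambda>(g, x). act g x)"
  using cont_action by (auto simp: cont_action_def)

lemma act_uminus: "x \<in> X \<Longrightarrow> act (- g) (act g x) = x"
  by (simp flip: act_add add: act_0)

lemma act_uminus': "x \<in> X \<Longrightarrow> act g (act (- g) x) = x"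
  by (simp flip: act_add add: act_0)

lemma continuous_on_act: "continuous_on X (act g)"
proof -
  have "continuous_on X ((\<lambda>(g, x). act g x) \<circ> Pair g)"
    by (rule continuous_on_compose)
      (auto intro!: continuous_intros continuous_on_subset[OF act_continuous])
  then show ?thesis by (simp add: o_def)
qed

lemma dense_orbit:
  assumes "x \<in> X" "openin (top_of_set X) V" "V \<noteq> {}"
  obtains g where "act g x \<in> V"
proof -
  obtain V' where V': "open V'" "V = X \<inter> V'" using assms(2) by (auto simp: openin_open)
  have "closure (range (\<lambda>g. act g x)) = X"
    using minimal_action assms(1) by (simp add: minimal_action_def)
  then have "V' \<inter> closure (range (\<lambda>g. act g x)) \<noteq> {}" using V' assms(3) by auto
  then have "V' \<inter> range (\<lambda>g. act g x) \<noteq> {}"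
    using open_Int_closure_eq_empty[OF V'(1)] by blast
  then show thesis using that V' act_in assms(1) by blast
qed

section \<open>The space of sequences and its coordinatewise action\<close>

text \<open>Sequences stand in for \<open>m\<close>-tuples, so one type serves every
  \<open>m\<close>; coordinates from \<open>m\<close> on are left unconstrained where tuples are
  meant.\<close>

definition seqs :: "(nat \<Rightarrow> 'x) set" where
  "seqs = {w. \<forall>i. w i \<in> X}"

text \<open>The diagonal action of \<open>g\<close> is the special case
  \<open>prod_act (\<lambda>_. g)\<close>.\<close>

definition prod_act :: "(nat \<Rightarrow> 'g) \<Rightarrow> (nat \<Rightarrow> 'x) \<Rightarrow> nat \<Rightarrow> 'x" where
  "prod_act h w = (\<lambda>i. act (h i) (w i))"

lemma compact_seqs: "compact seqs"
proof -
  have "compactin (product_topology (\<lambda>_. euclidean) UNIV) (PiE UNIV (\<lambda>_ :: nat. X))"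
    using compact_X by (subst compactin_PiE) auto
  then have "compact (PiE UNIV (\<lambda>_ :: nat. X))"
    by (simp add: euclidean_product_topology)
  moreover have "PiE UNIV (\<lambda>_ :: nat. X) = seqs" by (auto simp: seqs_def)
  ultimately show ?thesis by simp
qed

lemma closed_seqs: "closed seqs"
  by (simp add: compact_imp_closed compact_seqs)

lemma prod_act_in: "w \<in> seqs \<Longrightarrow> prod_act h w \<in> seqs"
  by (simp add: seqs_def prod_act_def act_in)

lemma prod_act_add: "w \<in> seqs \<Longrightarrow> prod_act (h + k) w = prod_act h (prod_act k w)"
  by (simp add: seqs_def prod_act_def act_add)

lemma continuous_on_prod_act: "continuous_on seqs (prod_act h)"
proof -
  have "continuous_on seqs (act (h i) \<circ> (\<lambda>w. w i))" for i
    by (rule continuous_on_compose[OF continuous_on_subset[OF continuous_on_product_coordinates]])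
      (auto simp: seqs_def intro!: continuous_on_subset[OF continuous_on_act])
  then show ?thesis
    unfolding prod_act_def by (intro continuous_on_coordinatewise_then_product) (simp add: o_def)
qed

text \<open>The coordinates move independently, so minimality of \<open>X\<close> applies to each
  one separately. Accuracy \<open>e / 3\<close> leaves room for the factor 2 in
  \<open>dist_fun_le\<close>.\<close>

lemma prod_dense_orbit:
  assumes w: "w \<in> seqs" and V: "openin (top_of_set seqs) V" "V \<noteq> {}"
  obtains h where "prod_act h w \<in> V"
proof -
  obtain v where v: "v \<in> V" using V by auto
  then have vs: "v \<in> seqs" using openin_subset[OF V(1)] by auto
  obtain e where e: "e > 0" "\<And>u. u \<in> seqs \<Longrightarrow> dist u v < e \<Longrightarrow> u \<in> V"
    using V(1) v unfolding openin_euclidean_subtopology_iff by blast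
  have "\<exists>g. dist (act g (w i)) (v i) < e / 3" for i
  proof -
    have "w i \<in> X" "v i \<in> X" using w vs by (auto simp: seqs_def)
    moreover have "openin (top_of_set X) (X \<inter> ball (v i) (e / 3))" by (simp add: openin_open_Int)
    moreover have "X \<inter> ball (v i) (e / 3) \<noteq> {}" using \<open>v i \<in> X\<close> e by auto
    ultimately obtain g where "act g (w i) \<in> X \<inter> ball (v i) (e / 3)"
      by (meson dense_orbit)
    then show ?thesis by (auto simp: dist_commute)
  qed
  then obtain h where "\<And>i. dist (act (h i) (w i)) (v i) < e / 3" by metis
  then have "dist (prod_act h w) v \<le> 2 * (e / 3)"
    by (intro dist_fun_le) (simp add: prod_act_def less_imp_le)
  then have "prod_act h w \<in> V" using e prod_act_in[OF w] by auto
  then show thesis by (rule that)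
qed

text \<open>The average runs over \<open>nat \<Rightarrow> 'g\<close>, acting coordinatewise, not just over the diagonal copy of
  \<open>'g\<close>: the coordinatewise action on sequences is minimal, hence the mean charges every open set.\<close>

lemma invariant_mean_on_seqs:
  assumes "X \<noteq> {}"
  obtains \<nu> where "fin_add_prob \<nu>" "\<And>A. \<nu> (A \<inter> seqs) = \<nu> A" "\<And>h A. \<nu> (prod_act h -` A) = \<nu> A"
    "\<And>V. openin (top_of_set seqs) V \<Longrightarrow> V \<noteq> {} \<Longrightarrow> \<nu> V > 0"
proof -
  \<comment> \<open>Sequences of group elements form an abelian group under pointwise
    addition.\<close>
  obtain \<mu> :: "(nat \<Rightarrow> 'g) set \<Rightarrow> real" where \<mu>: "fin_add_prob \<mu>" "\<And>a A. \<mu> ((+) a -` A) = \<mu> A"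
    using invariant_mean_exists by blast
  obtain x where "x \<in> X" using assms by auto
  then have "(\<lambda>_. x) \<in> seqs" by (simp add: seqs_def)
  then obtain w where w: "w \<in> seqs" by blast
  \<comment> \<open>Push-forward of the group mean along the orbit map of \<open>w\<close>.\<close>
  define \<nu> where "\<nu> A = \<mu> ((\<lambda>h. prod_act h w) -` A)" for A
  have \<nu>: "fin_add_prob \<nu>" unfolding \<nu>_def by (rule fin_add_prob_vimage[OF \<mu>(1)])
  have restr: "\<nu> (A \<inter> seqs) = \<nu> A" for A
  proof -
    have "(\<lambda>h. prod_act h w) -` (A \<inter> seqs) = (\<lambda>h. prod_act h w) -` A"
      using prod_act_in[OF w] by auto
    then show ?thesis by (simp add: \<nu>_def)
  qed
  have inv: "\<nu> (prod_act h -` A) = \<nu> A" for h A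
  proof -
    have "(\<lambda>k. prod_act k w) -` prod_act h -` A = (+) h -` (\<lambda>k. prod_act k w) -` A"
      using prod_act_add[OF w] by auto
    then show ?thesis by (simp add: \<nu>_def \<mu>(2))
  qed
  have "\<nu> V > 0" if V: "openin (top_of_set seqs) V" "V \<noteq> {}" for V
  proof -
    have op: "openin (top_of_set seqs) (seqs \<inter> prod_act h -` V)" for h
      using continuous_openin_preimage[OF continuous_on_prod_act _ V(1)] prod_act_in by auto
    \<comment> \<open>By minimality and compactness finitely many preimages of \<open>V\<close>
      cover \<open>seqs\<close>. All have the same mean as \<open>V\<close>, so this mean cannot be
      0.\<close>
    have cov: "seqs \<subseteq> (\<Union>h. seqs \<inter> prod_act h -` V)"
    proof
      fix v assume "v \<in> seqs"
      moreover obtain h where "prod_act h v \<in> V" using prod_dense_orbit[OF \<open>v \<in> seqs\<close> V] .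
      ultimately show "v \<in> (\<Union>h. seqs \<inter> prod_act h -` V)" by auto
    qed
    obtain D where "D \<subseteq> range (\<lambda>h. seqs \<inter> prod_act h -` V)" "finite D" "seqs \<subseteq> \<Union> D"
      using compact_eq_openin_cover[THEN iffD1, OF compact_seqs, rule_format,
          of "range (\<lambda>h. seqs \<inter> prod_act h -` V)"] op cov by auto
    then obtain H where H: "finite H" "seqs \<subseteq> (\<Union>h\<in>H. seqs \<inter> prod_act h -` V)"
      by (metis finite_subset_image)
    have "1 = \<nu> (UNIV \<inter> seqs)" using fin_add_prob_UNIV[OF \<nu>] restr[of UNIV] by simp
    also have "\<dots> \<le> \<nu> (\<Union>h\<in>H. prod_act h -` V)"
      by (rule fin_add_prob_mono[OF \<nu>]) (use H in auto)
    also have "\<dots> \<le> (\<Sum>h\<in>H. \<nu> (prod_act h -` V))"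
      by (rule fin_add_prob_UN_le[OF \<nu> H(1)])
    also have "\<dots> = real (card H) * \<nu> V" by (simp add: inv)
    finally have "\<nu> V \<noteq> 0" by auto
    then show ?thesis using fin_add_prob_nonneg[OF \<nu>, of V] by simp
  qed
  then show thesis using that[OF \<nu> restr inv] by blast
qed

end

section \<open>Slices of closed invariant sets\<close>

context minimal_flow
begin

text \<open>Coordinate \<open>i\<close> of \<open>w\<close> is a dummy, overwritten by
  \<open>x\<close>. Thus all slices lie in the one space \<open>seqs\<close>, without
  reindexing.\<close>

definition slice :: "(nat \<Rightarrow> 'x) set \<Rightarrow> nat \<Rightarrow> 'x \<Rightarrow> (nat \<Rightarrow> 'x) set" where
  "slice N i x = {w \<in> seqs. w(i := x) \<in> N}"

lemma slice_subset: "slice N i x \<subseteq> seqs"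
  by (auto simp: slice_def)

lemma continuous_on_fun_upd:
  fixes i :: nat
  shows "continuous_on S (\<lambda>(y::'x, w). w(i := y))"
proof -
  have "continuous_on S (\<lambda>z::'x \<times> (nat \<Rightarrow> 'x). ((snd z)(i := fst z)) j)" for j
  proof (cases "j = i")
    case False
    have "continuous_on S ((\<lambda>w. w j) \<circ> (snd :: 'x \<times> (nat \<Rightarrow> 'x) \<Rightarrow> _))"
      by (rule continuous_on_compose)
        (auto intro!: continuous_on_snd continuous_on_id
          continuous_on_subset[OF continuous_on_product_coordinates])
    with False show ?thesis by (simp add: o_def)
  qed (auto intro!: continuous_on_fst continuous_on_id)
  then show ?thesis
    by (auto simp: case_prod_unfold intro!: continuous_on_coordinatewise_then_product)
qed

text \<open>Tube argument: the pairs \<open>(y, w)\<close> with \<open>w\<close> in the slice at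
  \<open>y\<close> but outside \<open>V\<close> form a compact set, whose projection to
  \<open>X\<close> is closed and misses \<open>x\<close>.\<close>

lemma slice_usc:
  assumes N: "closed N" and x: "x \<in> X" and V: "openin (top_of_set seqs) V" "slice N i x \<subseteq> V"
  obtains d where "d > 0" "\<And>y. y \<in> X \<Longrightarrow> dist y x < d \<Longrightarrow> slice N i y \<subseteq> V"
proof -
  obtain V' where V': "open V'" "V = seqs \<inter> V'" using V by (auto simp: openin_open)
  define K where "K = (X \<times> seqs) \<inter> ((\<lambda>(y, w). w(i := y)) -` N \<inter> (UNIV \<times> - V'))"
  have "closed ((\<lambda>(y::'x, w). w(i := y)) -` N)"
    by (intro closed_vimage N continuous_on_fun_upd)
  moreover have "closed ((UNIV :: 'x set) \<times> - V')"
    using V' by (intro closed_Times) auto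
  ultimately have "compact K"
    unfolding K_def by (intro compact_Int_closed compact_Times compact_X compact_seqs closed_Int)
  then have "closed (fst ` K)"
    by (intro compact_imp_closed compact_continuous_image continuous_on_fst continuous_on_id)
  moreover have "x \<in> - fst ` K"
    using V V' by (auto simp: K_def slice_def)
  ultimately obtain d where d: "d > 0" "ball x d \<subseteq> - fst ` K"
    by (meson open_Compl open_contains_ball)
  have "slice N i y \<subseteq> V" if y: "y \<in> X" "dist y x < d" for y
  proof
    fix w assume w: "w \<in> slice N i y"
    have "y \<in> ball x d" using y by (simp add: dist_commute)
    then have "(y, w) \<notin> K" using d(2) by force
    then show "w \<in> V" using w y V' by (auto simp: K_def slice_def)
  qed
  with d show thesis using that by blast
qed

lemma closed_slice:
  assumes "closed N"
  shows "closed (slice N i x)"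
proof -
  have "continuous_on UNIV ((\<lambda>(y::'x, w). w(i := y)) \<circ> Pair x)"
    by (intro continuous_on_compose continuous_on_fun_upd continuous_intros)
  then have "closed ((\<lambda>w. w(i := x)) -` N)"
    by (intro closed_vimage assms) (simp add: o_def)
  moreover have "slice N i x = seqs \<inter> (\<lambda>w. w(i := x)) -` N" by (auto simp: slice_def)
  ultimately show ?thesis using closed_seqs by (simp add: closed_Int)
qed

text \<open>Invariance of \<open>N\<close> under \<open>g\<close> gives one inclusion, invariance
  under \<open>- g\<close> the other.\<close>

lemma slice_act:
  assumes N: "\<forall>g. \<forall>w\<in>N. prod_act (\<lambda>_. g) w \<in> N" and x: "x \<in> X"
  shows "slice N i x = seqs \<inter> prod_act (\<lambda>_. g) -` slice N i (act g x)"
proof (intro set_eqI iffI)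
  fix w assume w: "w \<in> slice N i x"
  have "prod_act (\<lambda>_. g) (w(i := x)) = (prod_act (\<lambda>_. g) w)(i := act g x)"
    by (auto simp: prod_act_def)
  with w N show "w \<in> seqs \<inter> prod_act (\<lambda>_. g) -` slice N i (act g x)"
    by (simp add: slice_def prod_act_in) metis
next
  fix w assume "w \<in> seqs \<inter> prod_act (\<lambda>_. g) -` slice N i (act g x)"
  then have w: "w \<in> seqs" "(prod_act (\<lambda>_. g) w)(i := act g x) \<in> N" by (auto simp: slice_def)
  have "prod_act (\<lambda>_. - g) ((prod_act (\<lambda>_. g) w)(i := act g x)) = w(i := x)"
    using w(1) x by (auto simp: prod_act_def seqs_def act_uminus fun_eq_iff)
  then show "w \<in> slice N i x" using N[rule_format, OF w(2), of "- g"] w(1) by (simp add: slice_def)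
qed

text \<open>Preimages of neighbourhoods of \<open>K\<close> are neighbourhoods of the preimage with
  the same mean. The reverse inequality comes from the inverse element, in
  \<open>overlap_act\<close>.\<close>

lemma outer_content_prod_act_le:
  assumes \<nu>: "fin_add_prob \<nu>" "\<And>A. \<nu> (A \<inter> seqs) = \<nu> A" "\<And>h A. \<nu> (prod_act h -` A) = \<nu> A"
    and K: "K \<subseteq> seqs"
  shows "outer_content \<nu> seqs (seqs \<inter> prod_act h -` K) \<le> outer_content \<nu> seqs K"
proof (rule outer_content_greatest[OF K])
  fix V assume V: "openin (top_of_set seqs) V" "K \<subseteq> V"
  have "openin (top_of_set seqs) (seqs \<inter> prod_act h -` V)"
    using continuous_openin_preimage[OF continuous_on_prod_act _ V(1)] prod_act_in by auto
  then have "outer_content \<nu> seqs (seqs \<inter> prod_act h -` K) \<le> \<nu> (seqs \<inter> prod_act h -` V)"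
    using V(2) by (intro outer_content_le[OF \<nu>(1)]) auto
  also have "\<dots> = \<nu> V" using \<nu>(2)[of "prod_act h -` V"] \<nu>(3) by (simp add: Int_commute)
  finally show "outer_content \<nu> seqs (seqs \<inter> prod_act h -` K) \<le> \<nu> V" .
qed

section \<open>The pseudometric of overlapping slices\<close>

context
  fixes \<nu> :: "(nat \<Rightarrow> 'x) set \<Rightarrow> real" and N :: "(nat \<Rightarrow> 'x) set" and i :: nat
  assumes \<nu>: "fin_add_prob \<nu>" "\<And>A. \<nu> (A \<inter> seqs) = \<nu> A" "\<And>h A. \<nu> (prod_act h -` A) = \<nu> A"
    and N: "closed N" "\<forall>g. \<forall>w\<in>N. prod_act (\<lambda>_. g) w \<in> N"
begin

text \<open>Since all slices turn out to have equal content,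
  \<open>overlap x x - overlap x y\<close> plays the role of half the content of the symmetric
  difference. Only closed sets occur in it, where supermodularity is available.\<close>

definition overlap :: "'x \<Rightarrow> 'x \<Rightarrow> real" where
  "overlap x y = outer_content \<nu> seqs (slice N i x \<inter> slice N i y)"

lemma overlap_act:
  assumes "x \<in> X" "y \<in> X"
  shows "overlap (act g x) (act g y) = overlap x y"
proof -
  have le: "overlap x y \<le> overlap (act g x) (act g y)" if "x \<in> X" "y \<in> X" for x y g
  proof -
    have "slice N i (act g x) \<inter> slice N i (act g y) \<subseteq> seqs" (is "?S \<subseteq> _")
      using slice_subset by blast
    moreover have "slice N i x \<inter> slice N i y = seqs \<inter> prod_act (\<lambda>_. g) -` ?S"
      using slice_act[OF N(2) that(1), of i g] slice_act[OF N(2) that(2), of i g] by auto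
    ultimately show ?thesis
      unfolding overlap_def using outer_content_prod_act_le[OF \<nu>, of ?S "\<lambda>_. g"] by presburger
  qed
  have "overlap (act g x) (act g y) \<le> overlap (act (- g) (act g x)) (act (- g) (act g y))"
    by (intro le act_in assms)
  then show ?thesis using le[OF assms, of g] assms by (simp add: act_uminus)
qed

lemma overlap_commute: "overlap x y = overlap y x"
  by (simp add: overlap_def Int_commute)

text \<open>The content of a slice is upper semicontinuous and invariant, hence constant by
  minimality.\<close>

lemma overlap_self_const:
  assumes "x \<in> X" "y \<in> X"
  shows "overlap x x = overlap y y"
proof -
  have le: "overlap y y \<le> overlap x x + e" if xy: "x \<in> X" "y \<in> X" and e: "e > 0" for x y e
  proof -
    obtain V where V: "openin (top_of_set seqs) V" "slice N i x \<subseteq> V"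
      "\<nu> V < outer_content \<nu> seqs (slice N i x) + e"
      using outer_content_approx[OF \<nu>(1) slice_subset e] by blast
    obtain d where d: "d > 0" "\<And>y. y \<in> X \<Longrightarrow> dist y x < d \<Longrightarrow> slice N i y \<subseteq> V"
      using slice_usc[OF N(1) xy(1) V(1,2)] by blast
    have "openin (top_of_set X) (X \<inter> ball x d)" "X \<inter> ball x d \<noteq> {}"
      using xy d by (auto simp: openin_open_Int)
    then obtain g where "act g y \<in> X \<inter> ball x d"
      using dense_orbit[OF xy(2)] by meson
    then have "slice N i (act g y) \<subseteq> V" using d by (auto simp: dist_commute)
    then have "overlap (act g y) (act g y) \<le> \<nu> V"
      unfolding overlap_def by (intro outer_content_le[OF \<nu>(1) V(1)]) auto
    then show ?thesis using V(3) overlap_act[OF xy(2,2)] by (simp add: overlap_def)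
  qed
  show ?thesis
    by (rule antisym; rule field_le_epsilon; rule le[OF _ _]) (use assms in auto)
qed

text \<open>Supermodularity for the two pairwise intersections: their union lies in the slice at
  \<open>y\<close>, their intersection in the slices at \<open>x\<close> and \<open>z\<close>. With
  constant self-overlap this is the triangle inequality for
  \<open>overlap x x - overlap x y\<close>.\<close>

lemma overlap_triangle:
  assumes "x \<in> X" "y \<in> X" "z \<in> X"
  shows "overlap x y + overlap y z \<le> overlap y y + overlap x z"
proof -
  let ?A = "slice N i x \<inter> slice N i y" and ?B = "slice N i y \<inter> slice N i z"
  have "overlap x y + overlap y z \<le>
      outer_content \<nu> seqs (?A \<union> ?B) + outer_content \<nu> seqs (?A \<inter> ?B)"
    unfolding overlap_def
    by (rule outer_content_supermodular[OF \<nu>(1) closed_seqs])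
      (use slice_subset in \<open>auto intro!: closed_Int closed_slice N\<close>)
  also have "outer_content \<nu> seqs (?A \<union> ?B) \<le> overlap y y"
    unfolding overlap_def by (rule outer_content_mono[OF \<nu>(1)]) (use slice_subset in auto)
  also have "outer_content \<nu> seqs (?A \<inter> ?B) \<le> overlap x z"
    unfolding overlap_def by (rule outer_content_mono[OF \<nu>(1)]) (use slice_subset in auto)
  finally show ?thesis by simp
qed

text \<open>For \<open>y\<close> near \<open>x\<close> both slices fit into one neighbourhood
  \<open>V\<close> of nearly minimal mean. As they have equal content, supermodularity forces a
  nearly full overlap.\<close>

lemma overlap_continuous:
  assumes x: "x \<in> X" and e: "e > 0"
  obtains d where "d > 0" "\<And>y. y \<in> X \<Longrightarrow> dist y x < d \<Longrightarrow> overlap x x - overlap x y < e"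
proof -
  obtain V where V: "openin (top_of_set seqs) V" "slice N i x \<subseteq> V"
    "\<nu> V < outer_content \<nu> seqs (slice N i x) + e"
    using outer_content_approx[OF \<nu>(1) slice_subset e] by blast
  obtain d where d: "d > 0" "\<And>y. y \<in> X \<Longrightarrow> dist y x < d \<Longrightarrow> slice N i y \<subseteq> V"
    using slice_usc[OF N(1) x V(1,2)] by blast
  have "overlap x x - overlap x y < e" if y: "y \<in> X" "dist y x < d" for y
  proof -
    have "overlap x x + overlap y y \<le>
        outer_content \<nu> seqs (slice N i x \<union> slice N i y) + overlap x y"
      unfolding overlap_def Int_absorb
      by (rule outer_content_supermodular[OF \<nu>(1) closed_seqs])
        (use slice_subset in \<open>auto intro!: closed_slice N\<close>)
    moreover have "outer_content \<nu> seqs (slice N i x \<union> slice N i y) \<le> \<nu> V"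
      using V d(2)[OF y] by (intro outer_content_le[OF \<nu>(1)]) auto
    ultimately show ?thesis
      using V(3) overlap_self_const[OF x y(1)] by (simp add: overlap_def)
  qed
  with d show thesis using that by blast
qed

text \<open>Otherwise a small closed ball inside \<open>V\<close> would miss the slice at
  \<open>y\<close>. Its content is positive, since it contains an open ball, so the overlap would
  fall short of the content of the slice at \<open>x\<close>.\<close>

lemma openin_subset_slice:
  assumes pos: "\<And>V. openin (top_of_set seqs) V \<Longrightarrow> V \<noteq> {} \<Longrightarrow> \<nu> V > 0"
    and xy: "overlap x x = overlap x y"
    and V: "openin (top_of_set seqs) V" "V \<subseteq> slice N i x"
  shows "V \<subseteq> slice N i y"
proof
  fix v assume v: "v \<in> V"
  show "v \<in> slice N i y"
  proof (rule ccontr)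
    assume nv: "v \<notin> slice N i y"
    obtain V' where V': "open V'" "V = seqs \<inter> V'" using V(1) by (auto simp: openin_open)
    have "open (V' - slice N i y)" using V' by (intro open_Diff closed_slice N)
    then obtain e where e: "e > 0" "cball v e \<subseteq> V' - slice N i y"
      using v nv V' open_contains_cball by blast
    let ?C = "seqs \<inter> cball v e" and ?A = "slice N i x \<inter> slice N i y"
    have "openin (top_of_set seqs) (seqs \<inter> ball v e)" "seqs \<inter> ball v e \<noteq> {}"
      using e v V' by (auto simp: openin_open_Int)
    then have "0 < \<nu> (seqs \<inter> ball v e)" by (rule pos)
    also have "\<dots> \<le> outer_content \<nu> seqs ?C"
      by (rule outer_content_greatest) (auto intro!: fin_add_prob_mono[OF \<nu>(1)])
    finally have "outer_content \<nu> seqs ?C > 0" .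
    moreover have "outer_content \<nu> seqs ?A + outer_content \<nu> seqs ?C
        \<le> outer_content \<nu> seqs (?A \<union> ?C) + outer_content \<nu> seqs (?A \<inter> ?C)"
      by (rule outer_content_supermodular[OF \<nu>(1) closed_seqs])
        (use slice_subset in \<open>auto intro!: closed_slice closed_Int closed_seqs N\<close>)
    moreover have "?A \<inter> ?C = {}" using e by auto
    moreover have "outer_content \<nu> seqs {} \<le> 0"
      using outer_content_le[OF \<nu>(1), of seqs "{}" "{}"] fin_add_prob_disjoint[OF \<nu>(1), of "{}" "{}"]
      by simp
    moreover have "outer_content \<nu> seqs (?A \<union> ?C) \<le> overlap x x"
      unfolding overlap_def
      by (rule outer_content_mono[OF \<nu>(1)]) (use e V V' slice_subset in auto)
    ultimately show False using xy by (simp add: overlap_def)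
  qed
qed

end

end

section \<open>Invariant pseudometrics and the maximal equicontinuous factor\<close>

lemma compact_dense_sequence:
  fixes X :: "'x::metric_space set"
  assumes "compact X" "X \<noteq> {}"
  obtains a :: "nat \<Rightarrow> 'x" where "range a \<subseteq> X" "\<And>x e. x \<in> X \<Longrightarrow> e > 0 \<Longrightarrow> \<exists>n. dist x (a n) < e"
proof -
  have "\<exists>T. finite T \<and> T \<subseteq> X \<and> X \<subseteq> (\<Union>x\<in>T. ball x (1 / real (Suc n)))" for n
    using seq_compact_imp_totally_bounded[OF compact_imp_seq_compact[OF assms(1)], rule_format,
        of "1 / real (Suc n)"] by auto
  then obtain T where T: "\<And>n. finite (T n)" "\<And>n. T n \<subseteq> X"
      "\<And>n. X \<subseteq> (\<Union>x\<in>T n. ball x (1 / real (Suc n)))"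
    by metis
  define S where "S = (\<Union>n. T n)"
  have S: "countable S" "S \<noteq> {}" "S \<subseteq> X"
    using T assms(2) by (auto simp: S_def countable_finite)
  have "\<exists>n. dist x (from_nat_into S n) < e" if x: "x \<in> X" "e > 0" for x e
  proof -
    obtain n where n: "1 / real (Suc n) < e" using nat_approx_posE[OF x(2)] by blast
    obtain s where s: "s \<in> T n" "dist x s < 1 / real (Suc n)"
      using T(3)[of n] x(1) by (auto simp: dist_commute)
    then have "s \<in> S" by (auto simp: S_def)
    then obtain k where "from_nat_into S k = s"
      using from_nat_into_surj S(1) by metis
    then show ?thesis using s n by (intro exI[of _ k]) simp
  qed
  moreover have "range (from_nat_into S) \<subseteq> X"
    using from_nat_into[OF S(2)] S(3) by auto
  ultimately show thesis using that by blast
qed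

text \<open>Divide \<open>X\<close> by \<open>D\<close>, realising the quotient in \<open>nat \<Rightarrow> real\<close> through the distances \<open>D x (a n)\<close> to
  a dense sequence \<open>a\<close>: this is an equicontinuous factor, hence a factor of \<open>Y\<close>.\<close>

lemma max_eq_factor_pseudometric:
  fixes act :: "'g::topological_group_add \<Rightarrow> 'x::metric_space \<Rightarrow> 'x"
    and act' :: "'g \<Rightarrow> 'y::metric_space \<Rightarrow> 'y" and D :: "'x \<Rightarrow> 'x \<Rightarrow> real"
  assumes max: "max_eq_factor act X act' Y p"
    and D_self: "\<And>x. x \<in> X \<Longrightarrow> D x x = 0"
    and D_sym: "\<And>x y. x \<in> X \<Longrightarrow> y \<in> X \<Longrightarrow> D x y = D y x"
    and D_triangle: "\<And>x y z. x \<in> X \<Longrightarrow> y \<in> X \<Longrightarrow> z \<in> X \<Longrightarrow> D x z \<le> D x y + D y z"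
    and D_act: "\<And>g x y. x \<in> X \<Longrightarrow> y \<in> X \<Longrightarrow> D (act g x) (act g y) = D x y"
    and D_cont: "\<And>x e. x \<in> X \<Longrightarrow> e > 0 \<Longrightarrow> \<exists>d>0. \<forall>y\<in>X. dist y x < d \<longrightarrow> D x y < e"
    and xy: "x \<in> X" "y \<in> X" "p x = p y"
  shows "D x y = 0"
proof -
  have ca: "cont_action act X" using max by (simp add: max_eq_factor_def factor_map_def)
  then have X: "compact X" and act_in: "\<And>g x. x \<in> X \<Longrightarrow> act g x \<in> X"
    and act_0: "\<And>x. x \<in> X \<Longrightarrow> act 0 x = x"
    and act_add: "\<And>x g h. x \<in> X \<Longrightarrow> act (g + h) x = act g (act h x)"
    and act_cont: "continuous_on (UNIV \<times> X) (\<lambda>(g, x). act g x)"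
    by (auto simp: cont_action_def)
  have D_nonneg: "0 \<le> D u v" if "u \<in> X" "v \<in> X" for u v
    using D_triangle[of u v u] D_self[of u] D_sym[of u v] that by simp
  obtain a where a: "range a \<subseteq> X" "\<And>x e. x \<in> X \<Longrightarrow> e > 0 \<Longrightarrow> \<exists>n::nat. dist x (a n) < e"
    using compact_dense_sequence[OF X] xy(1) by blast
  have a_in: "a n \<in> X" for n using a(1) by auto
  define q where "q x = (\<lambda>n. D x (a n))" for x
  have q_le: "dist (q u) (q v) \<le> 2 * D u v" if "u \<in> X" "v \<in> X" for u v
  proof (rule dist_fun_le)
    fix n
    show "dist (q u n) (q v n) \<le> D u v"
      using D_triangle[OF that a_in[of n]] D_triangle[OF that(2,1) a_in[of n]] D_sym[OF that]
      by (simp add: q_def dist_real_def abs_le_iff)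
  qed
  have q_eq: "D u v = 0" if uv: "u \<in> X" "v \<in> X" "q u = q v" for u v
  proof (rule antisym)
    show "D u v \<le> 0"
    proof (rule field_le_epsilon)
      fix e :: real assume "e > 0"
      then obtain d where d: "d > 0" "\<And>y. y \<in> X \<Longrightarrow> dist y u < d \<Longrightarrow> D u y < e / 2"
        using D_cont[OF uv(1), of "e / 2"] by auto
      obtain n where "dist u (a n) < d" using a(2)[OF uv(1) d(1)] by auto
      then have "D u (a n) < e / 2" using d(2)[OF a_in] by (simp add: dist_commute)
      moreover have "D v (a n) = D u (a n)" using uv(3) unfolding q_def by metis
      ultimately show "D u v \<le> 0 + e"
        using D_triangle[OF uv(1) a_in uv(2), of n] D_sym[OF a_in uv(2), of n] by linarith
    qed
  qed (rule D_nonneg[OF uv(1,2)])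
  have q_cont: "continuous_on X q"
    unfolding continuous_on_iff
  proof (intro ballI allI impI)
    fix u and e :: real assume u: "u \<in> X" and "e > 0"
    then obtain d where d: "d > 0" "\<And>y. y \<in> X \<Longrightarrow> dist y u < d \<Longrightarrow> D u y < e / 2"
      using D_cont[OF u, of "e / 2"] by auto
    then show "\<exists>d>0. \<forall>v\<in>X. dist v u < d \<longrightarrow> dist (q v) (q u) < e"
      using q_le[OF _ u] D_sym[OF _ u] by (intro exI[of _ d]) force
  qed
  have D_cont2: "continuous_on (X \<times> X) (\<lambda>(u, v). D u v)"
    unfolding continuous_on_iff
  proof (intro ballI allI impI, clarify)
    fix u v and e :: real assume uv: "u \<in> X" "v \<in> X" and "e > 0"
    then have e2: "e / 2 > 0" by simp
    obtain d1 where d1: "d1 > 0" "\<And>y. y \<in> X \<Longrightarrow> dist y u < d1 \<Longrightarrow> D u y < e / 2"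
      using D_cont[OF uv(1) e2] by auto
    obtain d2 where d2: "d2 > 0" "\<And>y. y \<in> X \<Longrightarrow> dist y v < d2 \<Longrightarrow> D v y < e / 2"
      using D_cont[OF uv(2) e2] by auto
    have "dist (D u' v') (D u v) < e"
      if uv': "u' \<in> X" "v' \<in> X" "dist (u', v') (u, v) < min d1 d2" for u' v'
    proof -
      have "dist u' u < d1" "dist v' v < d2"
        using uv'(3) dist_fst_le[of "(u', v')" "(u, v)"] dist_snd_le[of "(u', v')" "(u, v)"] by auto
      then have "D u u' < e / 2" "D v v' < e / 2" using d1 d2 uv' by auto
      moreover have "D u' v' \<le> D u' u + D u v'" "D u v' \<le> D u v + D v v'"
        "D u v \<le> D u u' + D u' v" "D u' v \<le> D u' v' + D v' v"
        by (intro D_triangle uv uv')+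
      moreover have "D u' u = D u u'" "D v' v = D v v'"
        using D_sym uv uv' by auto
      ultimately show ?thesis by (simp add: dist_real_def abs_less_iff)
    qed
    then show "\<exists>d>0. \<forall>z\<in>X \<times> X. dist z (u, v) < d \<longrightarrow>
        dist (case z of (u, v) \<Rightarrow> D u v) (D u v) < e"
      using d1(1) d2(1) by (intro exI[of _ "min d1 d2"]) auto
  qed
  \<comment> \<open>The pairs with \<open>D\<close> at least \<open>e\<close> form a compact set, on
    which the \<open>q\<close>-distance attains a minimum; by \<open>q_eq\<close> this minimum is
    positive.\<close>
  have q_inverse: "\<exists>d>0. \<forall>u\<in>X. \<forall>v\<in>X. dist (q u) (q v) < d \<longrightarrow> D u v < e" if "e > 0" for e
  proof -
    define K where "K = (X \<times> X) \<inter> (\<lambda>(u, v). D u v) -` {e..}"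
    have "closedin (top_of_set (X \<times> X)) K"
      unfolding K_def by (rule continuous_closedin_preimage[OF D_cont2]) auto
    then have K: "compact K"
      using closedin_compact X compact_Times by blast
    show ?thesis
    proof (cases "K = {}")
      case True
      then show ?thesis by (intro exI[of _ 1]) (auto simp: K_def not_le[symmetric])
    next
      case False
      have "continuous_on K (\<lambda>z. dist (q (fst z)) (q (snd z)))"
        by (intro continuous_on_dist continuous_on_compose2[OF q_cont] continuous_on_fst
            continuous_on_snd continuous_on_id) (auto simp: K_def)
      then obtain z where z: "z \<in> K"
        "\<And>w. w \<in> K \<Longrightarrow> dist (q (fst z)) (q (snd z)) \<le> dist (q (fst w)) (q (snd w))"
        using continuous_attains_inf[OF K False] by blast
      have "dist (q (fst z)) (q (snd z)) > 0"
      proof (rule ccontr)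
        assume "\<not> ?thesis"
        then have "q (fst z) = q (snd z)" by simp
        then show False using q_eq[of "fst z" "snd z"] z(1) \<open>e > 0\<close> by (auto simp: K_def)
      qed
      moreover have "D u v < e"
        if "u \<in> X" "v \<in> X" "dist (q u) (q v) < dist (q (fst z)) (q (snd z))" for u v
        using z(2)[of "(u, v)"] that by (force simp: K_def)
      ultimately show ?thesis by blast
    qed
  qed
  \<comment> \<open>\<open>r\<close> picks representatives. The induced action does not depend on
    the choice, because \<open>D\<close> is invariant and \<open>q\<close> identifies points at
    \<open>D\<close>-distance 0.\<close>
  define r where "r z = (SOME x. x \<in> X \<and> q x = z)" for z
  have r: "r (q u) \<in> X" "q (r (q u)) = q u" if "u \<in> X" for u
    unfolding r_def using someI[of "\<lambda>x. x \<in> X \<and> q x = q u" u] that by auto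
  define act'' where "act'' g z = q (act g (r z))" for g z
  have act'': "act'' g (q u) = q (act g u)" if u: "u \<in> X" for g u
  proof -
    have "D (r (q u)) u = 0" by (intro q_eq r u)
    then have "dist (q (act g (r (q u)))) (q (act g u)) \<le> 0"
      using q_le[OF act_in[OF r(1)[OF u]] act_in[OF u], of g g] D_act[OF r(1)[OF u] u, of g] by simp
    then show ?thesis by (simp add: act''_def)
  qed
  have "continuous_on (UNIV \<times> q ` X) (\<lambda>(g, z). act'' g z)"
    unfolding continuous_on_def
  proof (intro ballI, clarify)
    fix g0 :: 'g and u assume u: "u \<in> X"
    show "((\<lambda>(g, z). act'' g z) \<longlongrightarrow> act'' g0 (q u)) (at (g0, q u) within UNIV \<times> q ` X)"
      (is "(_ \<longlongrightarrow> _) ?F")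
    proof (rule tendstoI)
      fix e :: real assume "e > 0"
      then have e4: "e / 4 > 0" by simp
      obtain d where d: "d > 0" "\<And>v v'. v \<in> X \<Longrightarrow> v' \<in> X \<Longrightarrow> dist (q v) (q v') < d \<Longrightarrow> D v v' < e / 4"
        using q_inverse[OF e4] by blast
      have "continuous_on UNIV ((\<lambda>(g, x). act g x) \<circ> (\<lambda>g. (g, u)))"
        by (rule continuous_on_compose)
          (auto intro!: continuous_intros continuous_on_subset[OF act_cont] simp: u)
      then have "((\<lambda>g. act g u) \<longlongrightarrow> act g0 u) (at g0)"
        by (simp add: continuous_on_def o_def)
      obtain d' where d': "d' > 0" "\<And>v. v \<in> X \<Longrightarrow> dist v (act g0 u) < d' \<Longrightarrow> D (act g0 u) v < e / 4"
        using D_cont[OF act_in[OF u] e4] by blast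
      have "continuous_on (UNIV \<times> q ` X) (\<lambda>z. act (fst z) u)"
        using continuous_on_compose2[OF \<open>continuous_on UNIV _\<close> continuous_on_fst[OF continuous_on_id]]
        by (simp add: o_def)
      then have "((\<lambda>z. act (fst z) u) \<longlongrightarrow> act g0 u) ?F"
        using u by (auto simp: continuous_on_def)
      then have "eventually (\<lambda>z. dist (act (fst z) u) (act g0 u) < d') ?F"
        using d'(1) by (rule tendstoD)
      moreover have "(snd \<longlongrightarrow> snd (g0, q u)) ?F"
        by (intro tendsto_snd tendsto_ident_at)
      then have "eventually (\<lambda>z. dist (snd z) (q u) < d) ?F"
        using d(1) by (auto dest: tendstoD)
      moreover have "eventually (\<lambda>z. z \<in> UNIV \<times> q ` X) ?F"
        by (simp add: eventually_at_filter)
      ultimately show "eventually (\<lambda>z. dist (case z of (g, z) \<Rightarrow> act'' g z) (act'' g0 (q u)) < e) ?F"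
      proof eventually_elim
        case (elim z)
        then obtain g v where z: "z = (g, q v)" and v: "v \<in> X" by auto
        \<comment> \<open>First \<open>v\<close> is exchanged for \<open>u\<close> under the same
          \<open>g\<close>, which costs \<open>D v u\<close> by invariance; then \<open>g\<close>
          moves to \<open>g0\<close> along the orbit of the fixed point \<open>u\<close>.\<close>
        have "D (act g v) (act g0 u) \<le> D (act g v) (act g u) + D (act g u) (act g0 u)"
          by (intro D_triangle act_in u v)
        also have "D (act g v) (act g u) = D v u" by (rule D_act[OF v u])
        also have "D v u < e / 4" using elim z d(2)[OF v u] by simp
        also have "D (act g u) (act g0 u) < e / 4"
          using elim z d'(2)[OF act_in[OF u], of g] D_sym[OF act_in act_in, OF u u, of g g0] by simp
        finally have "D (act g v) (act g0 u) < e / 2" by simp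
        then show ?case
          using q_le[OF act_in[OF v] act_in[OF u], of g g0] by (simp add: z act'' u v)
      qed
    qed
  qed
  moreover have "compact (q ` X)" by (intro compact_continuous_image q_cont X)
  ultimately have "cont_action act'' (q ` X)"
    unfolding cont_action_def by (auto simp: act'' act_in act_0 act_add)
  then have "factor_map act X act'' (q ` X) q"
    unfolding factor_map_def using ca q_cont by (simp add: act'')
  moreover have "equicontinuous_action act'' (q ` X)"
    unfolding equicontinuous_action_def
  proof (intro allI impI)
    fix e :: real assume "e > 0"
    then obtain d where d: "d > 0" "\<And>v v'. v \<in> X \<Longrightarrow> v' \<in> X \<Longrightarrow> dist (q v) (q v') < d \<Longrightarrow> D v v' < e / 2"
      using q_inverse[of "e / 2"] by auto
    have "dist (act'' g (q u)) (act'' g (q v)) < e" if uv: "u \<in> X" "v \<in> X" "dist (q u) (q v) < d" for u v g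
      using q_le[OF act_in[OF uv(1)] act_in[OF uv(2)], of g g] d(2)[OF uv] D_act[OF uv(1,2), of g]
      by (simp add: act'' uv)
    then show "\<exists>d>0. \<forall>y\<in>q ` X. \<forall>y'\<in>q ` X. dist y y' < d \<longrightarrow> (\<forall>g. dist (act'' g y) (act'' g y') < e)"
      using d(1) by blast
  qed
  ultimately obtain f where "\<forall>x\<in>X. q x = f (p x)"
    using max unfolding max_eq_factor_def by blast
  then have "q x = q y" using xy by simp
  then show ?thesis using q_eq xy by blast
qed

section \<open>Fibres of the maximal equicontinuous factor\<close>

context minimal_flow
begin

text \<open>The overlap pseudometric is continuous and invariant, hence vanishes on fibres of
  \<open>p\<close>, and \<open>openin_subset_slice\<close> applies.\<close>

lemma open_subset_slice_fibre:
  fixes act' :: "'g \<Rightarrow> 'y::metric_space \<Rightarrow> 'y"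
  assumes max: "max_eq_factor act X act' Y p"
    and N: "closed N" "\<forall>g. \<forall>w\<in>N. prod_act (\<lambda>_. g) w \<in> N"
    and xy: "x \<in> X" "y \<in> X" "p x = p y"
    and V: "openin (top_of_set seqs) V" "V \<subseteq> slice N i x"
  shows "V \<subseteq> slice N i y"
proof -
  have "X \<noteq> {}" using xy by auto
  then obtain \<nu> where \<nu>: "fin_add_prob \<nu>" "\<And>A. \<nu> (A \<inter> seqs) = \<nu> A"
      "\<And>h A. \<nu> (prod_act h -` A) = \<nu> A"
    and pos: "\<And>V. openin (top_of_set seqs) V \<Longrightarrow> V \<noteq> {} \<Longrightarrow> \<nu> V > 0"
    using invariant_mean_on_seqs by blast
  let ?o = "overlap \<nu> N i"
  note const = overlap_self_const[OF \<nu> N, where i = i]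
  have "?o x x - ?o x y = 0"
  proof (rule max_eq_factor_pseudometric[OF max, where D = "\<lambda>x y. ?o x x - ?o x y"])
    show "?o u u - ?o u u = 0" for u by simp
    show "?o u u - ?o u v = ?o v v - ?o v u" if "u \<in> X" "v \<in> X" for u v
      using const[OF that] overlap_commute[OF \<nu> N, where i = i and x = u and y = v] by simp
    show "?o u u - ?o u w \<le> ?o u u - ?o u v + (?o v v - ?o v w)"
      if "u \<in> X" "v \<in> X" "w \<in> X" for u v w
      using overlap_triangle[OF \<nu> N that, where i = i] by simp
    show "?o (act g u) (act g u) - ?o (act g u) (act g v) = ?o u u - ?o u v"
      if "u \<in> X" "v \<in> X" for g u v
      using overlap_act[OF \<nu> N that, where i = i and g = g]
        overlap_act[OF \<nu> N that(1,1), where i = i and g = g] by simp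
    show "\<exists>d>0. \<forall>v\<in>X. dist v u < d \<longrightarrow> ?o u u - ?o u v < e" if "u \<in> X" "e > 0" for u e
      using overlap_continuous[OF \<nu> N that] by metis
  qed (use xy in auto)
  then have "?o x x = ?o x y" by simp
  show ?thesis
    by (rule openin_subset_slice[where \<nu> = \<nu> and N = N and i = i and x = x and y = y, OF \<nu> N _ _ V])
      (fact pos, fact)
qed

text \<open>Semi-openness of \<open>p\<close>, obtained from a finite cover of \<open>X\<close> by translates of the saturation of
  the ball: in a cover of least size each member has interior.\<close>

lemma saturated_open_over_ball:
  fixes p :: "'x \<Rightarrow> 'y::metric_space"
  assumes p: "continuous_on X p" "\<forall>g. \<forall>x\<in>X. p (act g x) = act' g (p x)"
    and a: "a \<in> X" "e > 0"
  obtains V where "openin (top_of_set X) V" "V \<noteq> {}"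
    "\<And>v. v \<in> V \<Longrightarrow> \<exists>c\<in>X \<inter> cball a e. p c = p v"
    "\<And>v x. v \<in> V \<Longrightarrow> x \<in> X \<Longrightarrow> p x = p v \<Longrightarrow> x \<in> V"
proof -
  define C where "C = p ` (X \<inter> cball a e)"
  have "continuous_on (X \<inter> cball a e) p" "compact (X \<inter> cball a e)"
    by (auto intro: continuous_on_subset[OF p(1)] compact_Int_closed[OF compact_X])
  then have C: "closed C"
    unfolding C_def by (intro compact_imp_closed compact_continuous_image)
  define covers where "covers H \<longleftrightarrow> finite H \<and> (\<forall>x\<in>X. \<exists>g\<in>H. p (act g x) \<in> C)" for H
  have "\<exists>H. covers H"
  proof -
    let ?O = "\<lambda>g. X \<inter> act g -` (X \<inter> ball a e)"
    have op: "openin (top_of_set X) (X \<inter> ball a e)" "X \<inter> ball a e \<noteq> {}"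
      using a by (auto simp: openin_open_Int)
    have "\<forall>S\<in>range ?O. openin (top_of_set X) S"
      using continuous_openin_preimage[OF continuous_on_act _ op(1)] act_in by auto
    moreover have "X \<subseteq> \<Union> (range ?O)"
    proof
      fix x assume x: "x \<in> X"
      obtain g where "act g x \<in> X \<inter> ball a e" using dense_orbit[OF x op] .
      then show "x \<in> \<Union> (range ?O)" using x by auto
    qed
    ultimately obtain D where D: "D \<subseteq> range ?O" "finite D" "X \<subseteq> \<Union> D"
      using compact_eq_openin_cover[THEN iffD1, OF compact_X, rule_format, of "range ?O"] by auto
    then obtain H where H: "finite H" "D = ?O ` H"
      by (metis finite_subset_image)
    have "\<exists>g\<in>H. p (act g x) \<in> C" if x: "x \<in> X" for x
    proof -
      obtain g where "g \<in> H" "act g x \<in> X \<inter> ball a e" using D(3) H(2) x by auto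
      then show ?thesis by (auto simp: C_def intro!: bexI[of _ g])
    qed
    then show ?thesis using H(1) unfolding covers_def by blast
  qed
  then obtain H where H: "covers H" "\<And>H'. covers H' \<Longrightarrow> card H \<le> card H'"
    using ex_has_least_nat[of covers _ card] by metis
  have "H \<noteq> {}" using H(1) a by (auto simp: covers_def)
  then obtain h where h: "h \<in> H" by auto
  \<comment> \<open>\<open>R\<close> is what the cover achieves without \<open>h\<close>. By
    minimality of \<open>card H\<close> it is not all of \<open>X\<close>, and every point outside
    \<open>R\<close> is carried by \<open>h\<close> over \<open>C\<close>; hence \<open>V\<close> is
    the \<open>h\<close>-translate of the complement of \<open>R\<close>.\<close>
  define R where "R = (\<Union>g\<in>H - {h}. X \<inter> (\<lambda>x. p (act g x)) -` C)"
  have cont: "continuous_on X (\<lambda>x. p (act g x))" for g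
    by (rule continuous_on_compose2[OF p(1) continuous_on_act]) (auto simp: act_in)
  have R: "closedin (top_of_set X) R"
    unfolding R_def using H(1) cont C
    by (intro closedin_Union ballI) (auto simp: covers_def intro!: continuous_closedin_preimage)
  define V where "V = X \<inter> act (- h) -` (X - R)"
  have "card (H - {h}) < card H" using H(1) h by (intro card_Diff1_less) (simp_all add: covers_def)
  then have "\<not> covers (H - {h})" using H(2)[of "H - {h}"] by linarith
  then obtain u where u: "u \<in> X" "u \<notin> R" using H(1) by (auto simp: covers_def R_def)
  show thesis
  proof (rule that)
    show "openin (top_of_set X) V"
      unfolding V_def
      by (rule continuous_openin_preimage[OF continuous_on_act, where T = X])
        (use act_in R in \<open>auto simp: closedin_def\<close>)
    show "V \<noteq> {}"
      using u act_in[OF u(1), of h] by (auto simp: V_def act_uminus)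
    fix v assume v: "v \<in> V"
    then have v': "v \<in> X" "act (- h) v \<in> X" "act (- h) v \<notin> R" by (auto simp: V_def)
    obtain g where "g \<in> H" "p (act g (act (- h) v)) \<in> C"
      using H(1) v'(2) by (auto simp: covers_def)
    then have "p (act h (act (- h) v)) \<in> C"
      using v' by (cases "g = h") (auto simp: R_def)
    then show "\<exists>c\<in>X \<inter> cball a e. p c = p v"
      using v' by (auto simp: C_def act_uminus')
    \<comment> \<open>Membership in \<open>R\<close> depends on a point only through its image under
      \<open>p\<close>, by equivariance.\<close>
    show "x \<in> V" if "x \<in> X" "p x = p v" for x
      using v' that by (auto simp: V_def R_def act_in p(2))
  qed
qed

lemma openin_box:
  assumes "\<And>i. i < m \<Longrightarrow> openin (top_of_set X) (S i)"
  shows "openin (top_of_set seqs) {w \<in> seqs. \<forall>i<m. w i \<in> S i}"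
  using assms
proof (induction m)
  case (Suc m)
  have "continuous_on seqs (\<lambda>w. w m)"
    by (rule continuous_on_subset[OF continuous_on_product_coordinates]) auto
  then have "openin (top_of_set seqs) (seqs \<inter> (\<lambda>w. w m) -` S m)"
    by (rule continuous_openin_preimage[where T = X]) (use Suc.prems in \<open>auto simp: seqs_def\<close>)
  moreover have "openin (top_of_set seqs) {w \<in> seqs. \<forall>i<m. w i \<in> S i}"
    using Suc by simp
  ultimately have "openin (top_of_set seqs)
      ({w \<in> seqs. \<forall>i<m. w i \<in> S i} \<inter> (seqs \<inter> (\<lambda>w. w m) -` S m))"
    using openin_Int by blast
  also have "{w \<in> seqs. \<forall>i<m. w i \<in> S i} \<inter> (seqs \<inter> (\<lambda>w. w m) -` S m) =
      {w \<in> seqs. \<forall>i<Suc m. w i \<in> S i}"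
    by (auto simp: less_Suc_eq)
  finally show ?case .
qed simp

text \<open>The coordinates are exchanged one at a time from the ball to the saturated set \<open>V\<close>; minimality
  then moves the whole fibre into \<open>V\<close>.\<close>

lemma fibre_regionally_proximal:
  fixes act' :: "'g \<Rightarrow> 'y::metric_space \<Rightarrow> 'y"
  assumes max: "max_eq_factor act X act' Y p"
    and a: "a \<in> X" "d > 0" and w: "w \<in> seqs" "\<And>i. p (w i) = p (w 0)"
  shows "w \<in> closure (\<Union>g. prod_act (\<lambda>_. g) ` {u \<in> seqs. \<forall>i<m. u i \<in> ball a d})"
    (is "_ \<in> closure ?S")
proof -
  define N where "N = closure ?S"
  have p: "continuous_on X p" "\<forall>g. \<forall>x\<in>X. p (act g x) = act' g (p x)"
    using max by (auto simp: max_eq_factor_def factor_map_def)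
  have S_sub: "?S \<subseteq> seqs" using prod_act_in by auto
  have S_act: "prod_act (\<lambda>_. g) v \<in> ?S" if v: "v \<in> ?S" for g v
  proof -
    obtain h u where u: "v = prod_act (\<lambda>_. h) u" "u \<in> seqs" "\<forall>i<m. u i \<in> ball a d"
      using v by blast
    then have "prod_act (\<lambda>_. g) v = prod_act (\<lambda>_. g + h) u"
      by (simp add: prod_act_def seqs_def act_add)
    then show ?thesis using u by auto
  qed
  have N_sub: "N \<subseteq> seqs" unfolding N_def by (rule closure_minimal[OF S_sub closed_seqs])
  have N: "closed N" "\<forall>g. \<forall>v\<in>N. prod_act (\<lambda>_. g) v \<in> N"
  proof -
    show "closed N" by (simp add: N_def)
    show "\<forall>g. \<forall>v\<in>N. prod_act (\<lambda>_. g) v \<in> N"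
    proof (intro allI ballI)
      fix g v assume "v \<in> N"
      have "prod_act (\<lambda>_. g) ` closure ?S \<subseteq> closure ?S"
      proof (rule image_closure_subset)
        show "continuous_on (closure ?S) (prod_act (\<lambda>_. g))"
          using N_sub unfolding N_def by (rule continuous_on_subset[OF continuous_on_prod_act])
        show "prod_act (\<lambda>_. g) ` ?S \<subseteq> closure ?S"
          using S_act by (intro order_trans[OF _ closure_subset] image_subsetI)
      qed simp
      then show "prod_act (\<lambda>_. g) v \<in> N" using \<open>v \<in> N\<close> by (auto simp: N_def)
    qed
  qed
  \<comment> \<open>Half the radius, so that the closed ball fits into the open ball
    \<open>U\<close>.\<close>
  have "d / 2 > 0" using a by simp
  obtain V where V: "openin (top_of_set X) V" "V \<noteq> {}"
    "\<And>v. v \<in> V \<Longrightarrow> \<exists>c\<in>X \<inter> cball a (d / 2). p c = p v"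
    "\<And>v x. v \<in> V \<Longrightarrow> x \<in> X \<Longrightarrow> p x = p v \<Longrightarrow> x \<in> V"
    by (rule saturated_open_over_ball[OF p a(1) \<open>d / 2 > 0\<close>]) blast
  define U where "U = X \<inter> ball a d"
  have U: "openin (top_of_set X) U" by (simp add: U_def openin_open_Int)
  have box: "{v \<in> seqs. \<forall>i<m. v i \<in> (if i < k then V else U)} \<subseteq> N" if "k \<le> m" for k
    using that
  proof (induction k)
    case 0
    have "v \<in> N" if v: "v \<in> seqs" "\<forall>i<m. v i \<in> U" for v
    proof -
      have "prod_act (\<lambda>_. 0) v = v" using v by (simp add: prod_act_def seqs_def act_0)
      moreover have "prod_act (\<lambda>_. 0) v \<in> ?S"
        using v by (intro UN_I imageI) (auto simp: U_def)
      ultimately have "v \<in> ?S" by simp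
      then show ?thesis unfolding N_def by (rule subsetD[OF closure_subset])
    qed
    then show ?case by auto
  next
    case (Suc k)
    show ?case
    proof
      fix v assume "v \<in> {v \<in> seqs. \<forall>i<m. v i \<in> (if i < Suc k then V else U)}"
      then have v: "v \<in> seqs" "\<And>i. i < m \<Longrightarrow> v i \<in> (if i < Suc k then V else U)" by auto
      have v_in: "v k \<in> X" using v(1) by (simp add: seqs_def)
      have "v k \<in> V" using v(2)[of k] Suc.prems by simp
      then obtain c where c: "c \<in> X" "c \<in> cball a (d / 2)" "p c = p (v k)" using V(3) by blast
      then have "c \<in> U" using a by (auto simp: U_def)
      \<comment> \<open>Coordinate \<open>k\<close> is left free because the slice overwrites it.
        The set is open and lies in the slice at \<open>c\<close>, so the value \<open>c\<close> in
        the ball can be replaced by \<open>v k\<close> in the same fibre.\<close>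
      define B where "B = {u \<in> seqs. \<forall>i<m. u i \<in> (if i < k then V else if i = k then X else U)}"
      have "openin (top_of_set seqs) B"
        unfolding B_def by (rule openin_box) (simp add: V U)
      then have "B \<subseteq> slice N k (v k)" if "B \<subseteq> slice N k c"
        using open_subset_slice_fibre[OF max N c(1) v_in c(3)] that by simp
      moreover have "B \<subseteq> slice N k c"
      proof
        fix u assume u: "u \<in> B"
        then have "u(k := c) \<in> {v \<in> seqs. \<forall>i<m. v i \<in> (if i < k then V else U)}"
          using \<open>c \<in> U\<close> c(1) by (auto simp: B_def seqs_def)
        then show "u \<in> slice N k c" using Suc u by (auto simp: slice_def B_def)
      qed
      ultimately have "B \<subseteq> slice N k (v k)" by simp
      moreover have "v \<in> B"
      proof -
        have "v i \<in> (if i < k then V else if i = k then X else U)" if "i < m" for i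
          using v(2)[OF that] v_in by (cases i k rule: linorder_cases) auto
        then show ?thesis using v(1) by (simp add: B_def)
      qed
      ultimately show "v \<in> N" by (auto simp: slice_def)
    qed
  qed
  have "w 0 \<in> X" using w(1) by (simp add: seqs_def)
  then obtain g where g: "act g (w 0) \<in> V" using dense_orbit V(1,2) by metis
  have "act g (w i) \<in> V" for i
  proof (rule V(4)[OF g])
    show "act g (w i) \<in> X" "p (act g (w i)) = p (act g (w 0))"
      using w(1) w(2)[of i] by (simp_all add: seqs_def act_in p(2))
  qed
  then have "prod_act (\<lambda>_. g) w \<in> N"
    using box[of m] prod_act_in[OF w(1)] by (auto simp: prod_act_def)
  then have "prod_act (\<lambda>_. - g) (prod_act (\<lambda>_. g) w) \<in> N" using N(2) by blast
  also have "prod_act (\<lambda>_. - g) (prod_act (\<lambda>_. g) w) = w"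
    using w(1) by (simp add: prod_act_def seqs_def act_uminus)
  finally show ?thesis by (simp add: N_def)
qed

section \<open>Distinct points in a fibre versus \<open>m\<close>-equicontinuity\<close>

text \<open>The tuple \<open>z\<close> is a limit of translates of tuples from an arbitrarily small
  ball around \<open>z 0\<close>, while its points keep the mutual distance
  \<open>Min E\<close>.\<close>

lemma m_equicontinuous_fibre:
  fixes act' :: "'g \<Rightarrow> 'y::metric_space \<Rightarrow> 'y"
  assumes max: "max_eq_factor act X act' Y p" and m: "m \<ge> 2"
    and equi: "m_equicontinuous m act X"
    and z: "inj_on z {..<m}" "\<And>i. i < m \<Longrightarrow> z i \<in> X" "\<And>i. i < m \<Longrightarrow> p (z i) = y"
  shows False
proof -
  \<comment> \<open>Padding with \<open>z 0\<close> keeps the whole sequence in the fibre.\<close>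
  define w where "w = (\<lambda>i. if i < m then z i else z 0)"
  have w: "w \<in> seqs" "\<And>i. p (w i) = p (w 0)" using z m by (auto simp: w_def seqs_def)
  define P where "P = {(i, j). i < m \<and> j < m \<and> i \<noteq> j}"
  define E where "E = (\<lambda>(i, j). dist (z i) (z j)) ` P"
  have "finite P" by (rule finite_subset[of _ "{..<m} \<times> {..<m}"]) (auto simp: P_def)
  moreover have "(0, 1) \<in> P" using m by (simp add: P_def)
  ultimately have E: "finite E" "E \<noteq> {}" by (auto simp: E_def)
  have pos: "Min E > 0"
    using E z(1) by (auto simp: Min_gr_iff E_def P_def inj_on_def)
  have sep: "Min E \<le> dist (z i) (z j)" if "i < m" "j < m" "i \<noteq> j" for i j
    by (rule Min_le[OF E(1)]) (use that in \<open>auto simp: E_def P_def\<close>)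
  have z0: "z 0 \<in> X" using z m by simp
  obtain d where d: "d > 0" "\<And>xs g. (\<forall>i<m. xs i \<in> X \<and> xs i \<in> ball (z 0) d) \<Longrightarrow>
      \<exists>i<m. \<exists>j<m. i \<noteq> j \<and> dist (act g (xs i)) (act g (xs j)) < Min E / 2"
    using equi z0 pos unfolding m_equicontinuous_def by (metis half_gt_zero)
  \<comment> \<open>Two errors below \<open>Min E / 4\<close> and one distance below
    \<open>Min E / 2\<close> add up to less than \<open>Min E\<close>.\<close>
  define T where "T = (\<Inter>i<m. (\<lambda>s. s i) -` ball (z i) (Min E / 4))"
  have "open T"
    unfolding T_def by (intro open_INT ballI open_vimage continuous_on_product_coordinates) auto
  moreover have "w \<in> T" using pos by (auto simp: T_def w_def)
  moreover have "w \<in> closure (\<Union>g. prod_act (\<lambda>_. g) ` {u \<in> seqs. \<forall>i<m. u i \<in> ball (z 0) d})"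
    by (rule fibre_regionally_proximal[OF max z0 d(1) w])
  ultimately obtain g u where u: "u \<in> seqs" "\<forall>i<m. u i \<in> ball (z 0) d" "prod_act (\<lambda>_. g) u \<in> T"
    using open_Int_closure_eq_empty[of T] by blast
  then obtain i j where ij: "i < m" "j < m" "i \<noteq> j"
      "dist (act g (u i)) (act g (u j)) < Min E / 2"
    using d(2)[of u g] by (auto simp: seqs_def)
  have "dist (z k) (act g (u k)) < Min E / 4" if "k < m" for k
    using u(3) that by (auto simp: T_def prod_act_def)
  from this[OF ij(1)] this[OF ij(2)] have "dist (z i) (z j) < Min E"
    using ij(4) dist_triangle[of "z i" "z j" "act g (u i)"]
      dist_triangle[of "act g (u i)" "z j" "act g (u j)"]
    by (simp add: dist_commute)
  then show False using sep[OF ij(1-3)] by simp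
qed

text \<open>Failure at \<open>x\<close> yields tuples shrinking to \<open>x\<close> with
  \<open>e\<close>-separated translates. A limit of the translates has distinct entries, and
  equicontinuity of \<open>Y\<close> gives these entries the same image.\<close>

lemma not_m_equicontinuous_fibre:
  fixes act' :: "'g \<Rightarrow> 'y::metric_space \<Rightarrow> 'y"
  assumes factor: "factor_map act X act' Y p" and equi: "equicontinuous_action act' Y"
    and m: "m > 0" and not: "\<not> m_equicontinuous m act X"
  obtains z where "inj_on z {..<m}" "\<And>i. i < m \<Longrightarrow> z i \<in> X" "\<And>i. i < m \<Longrightarrow> p (z i) = p (z 0)"
proof -
  have p: "continuous_on X p" "\<And>g x. x \<in> X \<Longrightarrow> p (act g x) = act' g (p x)" "p ` X = Y"
    using factor by (auto simp: factor_map_def)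
  obtain x e where x: "x \<in> X" "e > 0"
    and bad: "\<And>d. d > 0 \<Longrightarrow> \<exists>xs g. (\<forall>i<m. xs i \<in> X \<and> xs i \<in> ball x d) \<and>
      (\<forall>i<m. \<forall>j<m. i \<noteq> j \<longrightarrow> e \<le> dist (act g (xs i)) (act g (xs j)))"
    using not unfolding m_equicontinuous_def
    by (simp add: not_less) (metis not_less)
  have "\<exists>xs g. (\<forall>i<m. xs i \<in> X \<and> xs i \<in> ball x (1 / real (Suc n))) \<and>
      (\<forall>i<m. \<forall>j<m. i \<noteq> j \<longrightarrow> e \<le> dist (act g (xs i)) (act g (xs j)))" for n
    by (rule bad) simp
  then obtain xs g where xs: "\<And>n i. i < m \<Longrightarrow> xs n i \<in> X"
      "\<And>n i. i < m \<Longrightarrow> dist x (xs n i) < 1 / real (Suc n)"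
    and sep: "\<And>n i j. i < m \<Longrightarrow> j < m \<Longrightarrow> i \<noteq> j \<Longrightarrow>
      e \<le> dist (act (g n) (xs n i)) (act (g n) (xs n j))"
    unfolding mem_ball by metis
  \<comment> \<open>The value \<open>x\<close> beyond \<open>m\<close> only keeps the sequence in
    \<open>seqs\<close>, where a convergent subsequence exists.\<close>
  define w where "w n = (\<lambda>i. if i < m then act (g n) (xs n i) else x)" for n
  have "w n \<in> seqs" for n using xs x by (auto simp: w_def seqs_def act_in)
  then obtain z r where z: "z \<in> seqs" "strict_mono (r :: nat \<Rightarrow> nat)" "(w \<circ> r) \<longlonglongrightarrow> z"
    using compact_imp_seq_compact[OF compact_seqs] unfolding seq_compact_def by metis
  have lim: "(\<lambda>n. act (g (r n)) (xs (r n) i)) \<longlonglongrightarrow> z i" if "i < m" for i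
  proof -
    have "isCont (\<lambda>s. s i) z"
      by (metis continuous_on_product_coordinates continuous_on_eq_continuous_at open_UNIV UNIV_I)
    then have "(\<lambda>n. (w \<circ> r) n i) \<longlonglongrightarrow> z i"
      by (rule isCont_tendsto_compose[OF _ z(3)])
    then show ?thesis using that by (simp add: o_def w_def)
  qed
  have xs_lim: "(\<lambda>n. xs (r n) i) \<longlonglongrightarrow> x" if i: "i < m" for i
  proof -
    have "(\<lambda>n. dist (xs n i) x) \<longlonglongrightarrow> 0"
    proof (rule tendsto_sandwich[OF _ _ tendsto_const LIMSEQ_inverse_real_of_nat])
      show "\<forall>\<^sub>F n in sequentially. dist (xs n i) x \<le> inverse (real (Suc n))"
        using xs(2)[OF i] by (auto simp: dist_commute inverse_eq_divide less_imp_le intro!: always_eventually)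
    qed simp
    then have "(\<lambda>n. xs n i) \<longlonglongrightarrow> x" by (subst tendsto_dist_iff)
    then show ?thesis using LIMSEQ_subseq_LIMSEQ[OF _ z(2)] by (simp add: o_def)
  qed
  have z_in: "z i \<in> X" for i using z(1) by (simp add: seqs_def)
  show thesis
  proof (rule that)
    show "inj_on z {..<m}"
    proof (rule inj_onI, rule ccontr)
      fix i j assume ij: "i \<in> {..<m}" "j \<in> {..<m}" "z i = z j" "i \<noteq> j"
      have "(\<lambda>n. dist (act (g (r n)) (xs (r n) i)) (act (g (r n)) (xs (r n) j))) \<longlonglongrightarrow> dist (z i) (z j)"
        using ij by (intro tendsto_dist lim) auto
      then have "e \<le> dist (z i) (z j)"
        by (rule LIMSEQ_le_const) (use sep ij in auto)
      then show False using ij x by simp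
    qed
    show "z i \<in> X" for i by (rule z_in)
    fix i assume i: "i < m"
    have p_lim: "(\<lambda>n. p (f n)) \<longlonglongrightarrow> p l" if "\<And>n. f n \<in> X" "l \<in> X" "f \<longlonglongrightarrow> l" for f l
      using p(1) that unfolding continuous_on_sequentially by (auto simp: o_def)
    let ?d = "\<lambda>n. dist (p (act (g (r n)) (xs (r n) i))) (p (act (g (r n)) (xs (r n) 0)))"
    have "?d \<longlonglongrightarrow> dist (p (z i)) (p (z 0))"
      using i m by (intro tendsto_dist p_lim lim z_in act_in xs) auto
    moreover have "?d \<longlonglongrightarrow> 0"
    proof (rule tendstoI)
      fix \<epsilon> :: real assume "\<epsilon> > 0"
      then obtain d where d: "d > 0" "\<And>y y' g. y \<in> Y \<Longrightarrow> y' \<in> Y \<Longrightarrow> dist y y' < d \<Longrightarrow>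
          dist (act' g y) (act' g y') < \<epsilon>"
        using equi unfolding equicontinuous_action_def by metis
      have "(\<lambda>n. dist (p (xs (r n) i)) (p (xs (r n) 0))) \<longlonglongrightarrow> dist (p x) (p x)"
        using i m by (intro tendsto_dist p_lim xs_lim x xs) auto
      then have "\<forall>\<^sub>F n in sequentially. dist (p (xs (r n) i)) (p (xs (r n) 0)) < d"
        using d(1) by (auto dest: order_tendstoD)
      then show "\<forall>\<^sub>F n in sequentially. dist (?d n) 0 < \<epsilon>"
      proof eventually_elim
        case (elim n)
        have "xs (r n) i \<in> X" "xs (r n) 0 \<in> X" using xs i m by auto
        then show ?case using d(2)[OF _ _ elim, of "g (r n)"] p by auto
      qed
    qed
    ultimately show "p (z i) = p (z 0)" using LIMSEQ_unique by fastforce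
  qed
qed

end

text \<open>An injective \<open>m\<close>-tuple in a fibre witnesses excess size uniformly, for
  finite and infinite fibres alike.\<close>

lemma max_rank_le_iff:
  fixes p :: "'x \<Rightarrow> 'y"
  assumes "m > 0" "p ` X = Y"
  shows "max_rank X Y p \<le> enat (m - 1) \<longleftrightarrow>
    \<not> (\<exists>z :: nat \<Rightarrow> 'x. \<exists>y. inj_on z {..<m} \<and> (\<forall>i<m. z i \<in> X \<and> p (z i) = y))"
    (is "_ \<longleftrightarrow> \<not> ?tuple")
proof -
  let ?F = "\<lambda>y. {x \<in> X. p x = y}"
  \<comment> \<open>Positivity of \<open>m\<close> makes the truncated \<open>m - 1\<close> a
    genuine predecessor.\<close>
  have "(let F = ?F y in if finite F then enat (card F) else \<infinity>) \<le> enat (m - 1) \<longleftrightarrow>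
      finite (?F y) \<and> card (?F y) < m" for y
    using assms(1) by (auto simp: Let_def)
  then have "max_rank X Y p \<le> enat (m - 1) \<longleftrightarrow> (\<forall>y\<in>Y. finite (?F y) \<and> card (?F y) < m)"
    unfolding max_rank_def SUP_le_iff by simp
  also have "\<dots> \<longleftrightarrow> \<not> ?tuple"
  proof (intro iffI notI ballI)
    assume small: "\<forall>y\<in>Y. finite (?F y) \<and> card (?F y) < m" and ?tuple
    then obtain z y where z: "inj_on z {..<m}" "\<And>i. i < m \<Longrightarrow> z i \<in> X \<and> p (z i) = y" by blast
    have "y \<in> Y" using z(2)[OF assms(1)] assms(2) by auto
    moreover have "card {..<m} \<le> card (?F y)"
      by (rule card_inj_on_le[OF z(1)]) (use z small \<open>y \<in> Y\<close> in auto)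
    ultimately show False using small by auto
  next
    fix y assume none: "\<not> ?tuple"
    show "finite (?F y) \<and> card (?F y) < m"
    proof (rule ccontr)
      assume "\<not> ?thesis"
      then have "infinite (?F y) \<or> m \<le> card (?F y)" by auto
      then have "\<exists>T. T \<subseteq> ?F y \<and> finite T \<and> card T = m"
      proof
        assume "infinite (?F y)"
        from infinite_arbitrarily_large[OF this, of m] show ?thesis by auto
      next
        assume "m \<le> card (?F y)"
        from obtain_subset_with_card_n[OF this] show ?thesis by metis
      qed
      then obtain T where T: "T \<subseteq> ?F y" "finite T" "card T = m" by blast
      then obtain z where "bij_betw z {0..<m} T" using ex_bij_betw_nat_finite by metis
      then have "inj_on z {..<m}" "\<forall>i<m. z i \<in> T"
        by (auto simp: bij_betw_def atLeast0LessThan)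
      then show False using none T(1) by blast
    qed
  qed
  finally show ?thesis .
qed

theorem theorem4p7:
  fixes act :: "'g::{topological_ab_group_add, t2_space} \<Rightarrow> 'x::metric_space \<Rightarrow> 'x"
    and X :: "'x set"
    and act' :: "'g \<Rightarrow> 'y::metric_space \<Rightarrow> 'y"
    and Y :: "'y set"
    and p :: "'x \<Rightarrow> 'y"
    and m :: nat
  assumes "locally compact (UNIV :: 'g set)"
    and "cont_action act X"
    and "minimal_action act X"
    and "max_eq_factor act X act' Y p"
    and "m \<ge> 2"
  shows "m_equicontinuous m act X \<longleftrightarrow> max_rank X Y p \<le> enat (m - 1)"
proof -
  interpret minimal_flow act X by unfold_locales fact+
  have factor: "factor_map act X act' Y p" "equicontinuous_action act' Y" and m: "m > 0"
    using assms by (auto simp: max_eq_factor_def)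
  then have "p ` X = Y" by (simp add: factor_map_def)
  note iff = max_rank_le_iff[OF m this]
  show ?thesis
  proof
    assume "m_equicontinuous m act X"
    then show "max_rank X Y p \<le> enat (m - 1)"
      unfolding iff using m_equicontinuous_fibre[OF assms(4,5)] by blast
  next
    assume "max_rank X Y p \<le> enat (m - 1)"
    then show "m_equicontinuous m act X"
      unfolding iff using not_m_equicontinuous_fibre[OF factor m] by metis
  qed
qed

end
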